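(* Let $n\ge 3$ and consider the affine Weyl group $W_{\mathrm{aff}}$ of type $A_{n-1}^{(1)}$. Let $\alpha\in\Pi_{\mathrm{aff}}^{\mathrm{re},+}$ with $\alpha<c$, and let $$\Pi_{\mathrm{aff}}^{\mathrm{re},+}(\alpha)=\{\beta'\in\Pi_{\mathrm{aff}}^{\mathrm{re},+}:\ \beta'<c,\ \text{and either } \beta'\le c-\alpha,\ \text{or both } \beta'>\alpha \text{ and } \beta'\perp\alpha\}.$$ Then: (1) $\Gamma_{c+\alpha}(id)=\{t_{\beta'}s_\alpha:\beta'\in\Pi_{\mathrm{aff}}^{\mathrm{re},+}(\alpha),\ \alpha_0\notin\operatorname{supp}(\beta')\}\cup\{t_{\beta'-c}s_\alpha:\beta'\in\Pi_{\mathrm{aff}}^{\mathrm{re},+}(\alpha),\ \alpha_0\in\operatorname{supp}(\beta')\}$; (2) $|\Gamma_{c+\alpha}(id)|=|\Pi_{\mathrm{aff}}^{\mathrm{re},+}(\alpha)|$; (3) $\ell(w)=2(n-1)+\ell(s_\alpha)$ for all $w\in\Gamma_{c+\alpha}(id)$.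
   Context: Roots. Let $n\ge 3$. Let $\alpha_0,\dots,\alpha_{n-1}$ (indices mod $n$) be the affine simple roots of type $A_{n-1}^{(1)}$, $Q_{\mathrm{aff}}=\bigoplus_{i=0}^{n-1}\mathbb Z\alpha_i$, with symmetric form $\langle\alpha_i,\alpha_i\rangle=2$, $\langle\alpha_i,\alpha_{i\pm1}\rangle=-1$, all other $\langle\alpha_i,\alpha_j\rangle=0$; $\perp$ refers to this form. For $a,b\in Q_{\mathrm{aff}}$, $a\le b$ means $b-a$ has non-negative coefficients, and $a<b$ means $a\le b$, $a\ne b$. Put $c=\sum_{i=0}^{n-1}\alpha_i$ (identified with the imaginary root $\delta$). Let $\Pi=\Pi^+\sqcup\Pi^-$ be the finite root system of type $A_{n-1}$ with simple roots $\alpha_1,\dots,\alpha_{n-1}$. The affine real roots are $\alpha+mc$ with $\alpha\in\Pi$, $m\in\mathbb Z$; such a root is positive if $m>0$, or $m=0$ and $\alpha\in\Pi^+$. The set of positive real roots is $\Pi_{\mathrm{aff}}^{\mathrm{re},+}$. For $\alpha=\sum a_i\alpha_i$, $\operatorname{supp}(\alpha)=\{\alpha_i:a_i\ne0\}$. Weyl group. For a real root $\alpha$, $s_\alpha(\mu)=\mu-\langle\mu,\alpha\rangle\alpha$. $W_{\mathrm{aff}}$ is the group generated by $s_i=s_{\alpha_i}$, $0\le i\le n-1$ (a Coxeter group with these generators), with length $\ell$ and Bruhat order $\le$. One has $W_{\mathrm{aff}}=W\ltimes Q$, where $W=\langle s_1,\dots,s_{n-1}\rangle$ and $Q=\bigoplus_{i=1}^{n-1}\mathbb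 Z\alpha_i$ (root and coroot lattices identified); $t_\mu$ denotes the image of $\mu\in Q$, with $s_{\alpha+mc}=s_\alpha t_{m\alpha}$ for $\alpha\in\Pi$, $m\in\mathbb Z$ (so $t_\mu(\nu)=\nu-\langle\mu,\nu\rangle c$). For a positive real root $\beta'<c$: $\beta'\in Q$ if $\alpha_0\notin\operatorname{supp}(\beta')$, and $\beta'-c\in Q$ if $\alpha_0\in\operatorname{supp}(\beta')$. Curve neighborhoods. The moment graph has vertex set $W_{\mathrm{aff}}$ and an edge $u\stackrel{\alpha}{\longrightarrow}us_\alpha$ of degree $\alpha$ for each $u\in W_{\mathrm{aff}}$, $\alpha\in\Pi_{\mathrm{aff}}^{\mathrm{re},+}$. The degree of a chain (a succession of adjacent edges, possibly empty) is the sum of the degrees of its edges. A degree is a tuple $\mathbf d=(d_0,\dots,d_{n-1})\in\mathbb Z_{\ge0}^n$, identified with $\sum d_i\alpha_i$; degrees are ordered componentwise. For $u\in W_{\mathrm{aff}}$, $\Gamma_{\mathbf d}(u)$ is the set of Bruhat-maximal elements of the set of all $v\in W_{\mathrm{aff}}$ that can be joined to some $u'\le u$ by a chain of degree $\le\mathbf d$. *)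

theory Defs
  imports Main "HOL-Library.Function_Algebras"
begin

text \<open>
  An element \<open>a\<^sub>0 \<alpha>\<^sub>0 + \<dots> + a\<^bsub>n-1\<^esub> \<alpha>\<^bsub>n-1\<^esub>\<close> of the affine root lattice is represented by its
  coefficient function \<open>a :: nat \<Rightarrow> int\<close>, which is \<open>0\<close> from \<open>n\<close> on. With this encoding
  addition, the relation \<open>\<le>\<close> and its strict part \<open><\<close> are the pointwise ones of the library,
  and a degree is a coefficient function with non-negative values.
\<close>

type_synonym lattice_elt = "nat \<Rightarrow> int"

definition smul :: "int \<Rightarrow> lattice_elt \<Rightarrow> lattice_elt" where
  "smul k a = (\<lambda>i. k * a i)"

definition simple_root :: "nat \<Rightarrow> lattice_elt" where
  "simple_root i = (\<lambda>j. if j = i then 1 else 0)"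

text \<open>The affine Cartan matrix; it is the one of type \<open>A\<^bsub>n-1\<^esub>\<^sup>(\<^sup>1\<^sup>)\<close> for \<open>n \<ge> 3\<close> only.\<close>

definition cartan :: "nat \<Rightarrow> nat \<Rightarrow> nat \<Rightarrow> int" where
  "cartan n i j =
     (if i = j then 2 else if j = (i + 1) mod n \<or> i = (j + 1) mod n then -1 else 0)"

definition form :: "nat \<Rightarrow> lattice_elt \<Rightarrow> lattice_elt \<Rightarrow> int" where
  "form n a b = (\<Sum>i<n. \<Sum>j<n. a i * b j * cartan n i j)"

definition delta :: "nat \<Rightarrow> lattice_elt" where
  "delta n = (\<Sum>i<n. simple_root i)"

definition supp :: "nat \<Rightarrow> lattice_elt \<Rightarrow> lattice_elt set" where
  "supp n a = {simple_root i | i. i < n \<and> a i \<noteq> 0}"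

text \<open>In type \<open>A\<^bsub>n-1\<^esub>\<close> the positive roots \<open>e\<^sub>i - e\<^bsub>j+1\<^esub>\<close> are the sums
  \<open>\<alpha>\<^sub>i + \<dots> + \<alpha>\<^sub>j\<close> of consecutive simple roots.\<close>

definition fin_pos_roots :: "nat \<Rightarrow> lattice_elt set" where
  "fin_pos_roots n = {(\<Sum>k=i..j. simple_root k) | i j. 1 \<le> i \<and> i \<le> j \<and> j \<le> n - 1}"

definition fin_roots :: "nat \<Rightarrow> lattice_elt set" where
  "fin_roots n = fin_pos_roots n \<union> uminus ` fin_pos_roots n"

definition pos_real_roots :: "nat \<Rightarrow> lattice_elt set" where
  "pos_real_roots n =
     {a + smul m (delta n) | a m. a \<in> fin_roots n \<and> (m > 0 \<or> m = 0 \<and> a \<in> fin_pos_roots n)}"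

text \<open>
  The affine Weyl group is realised by its action on the affine root lattice, which is faithful:
  modulo \<open>\<delta>\<close> the group \<open>W\<close> acts faithfully, and the form is nondegenerate on the finite
  root lattice, so no nontrivial translation acts trivially. The maps below are defined on all
  functions \<open>nat \<Rightarrow> int\<close>; coefficients with index \<open>\<ge> n\<close> are neither used nor changed, so equality
  of such maps is equality of the maps on the lattice.
\<close>

type_synonym lattice_map = "lattice_elt \<Rightarrow> lattice_elt"

definition root_refl :: "nat \<Rightarrow> lattice_elt \<Rightarrow> lattice_map" where
  "root_refl n a = (\<lambda>x. x - smul (form n x a) a)"

definition transl :: "nat \<Rightarrow> lattice_elt \<Rightarrow> lattice_map" where
  "transl n mu = (\<lambda>x. x - smul (form n mu x) (delta n))"

definition word_prod :: "nat \<Rightarrow> nat list \<Rightarrow> lattice_map" where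
  "word_prod n is = foldr (\<lambda>i w. root_refl n (simple_root i) \<circ> w) is id"

text \<open>The simple reflections are involutions, so the group they generate consists of
  the products of words in them.\<close>

definition W_aff :: "nat \<Rightarrow> lattice_map set" where
  "W_aff n = {word_prod n is | is. set is \<subseteq> {..<n}}"

definition len :: "nat \<Rightarrow> lattice_map \<Rightarrow> nat" where
  "len n w = (LEAST k. \<exists>is. set is \<subseteq> {..<n} \<and> length is = k \<and> word_prod n is = w)"

definition cox_reflections :: "nat \<Rightarrow> lattice_map set" where
  "cox_reflections n = {w \<circ> root_refl n (simple_root i) \<circ> inv w | w i. w \<in> W_aff n \<and> i < n}"

definition bruhat_step :: "nat \<Rightarrow> lattice_map \<Rightarrow> lattice_map \<Rightarrow> bool" where
  "bruhat_step n u v \<longleftrightarrow> (\<exists>t \<in> cox_reflections n. v = u \<circ> t) \<and> len n u < len n v"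

definition bruhat_le :: "nat \<Rightarrow> lattice_map \<Rightarrow> lattice_map \<Rightarrow> bool" where
  "bruhat_le n u v \<longleftrightarrow> u \<in> W_aff n \<and> v \<in> W_aff n \<and> (bruhat_step n)\<^sup>*\<^sup>* u v"

text \<open>\<open>chain n u v d\<close>: the moment graph has a chain of degree \<open>d\<close> from \<open>u\<close> to \<open>v\<close>.\<close>

inductive chain :: "nat \<Rightarrow> lattice_map \<Rightarrow> lattice_map \<Rightarrow> lattice_elt \<Rightarrow> bool" for n where
  chain_empty: "u \<in> W_aff n \<Longrightarrow> chain n u u 0"
| chain_edge: "chain n u v d \<Longrightarrow> a \<in> pos_real_roots n \<Longrightarrow> chain n u (v \<circ> root_refl n a) (d + a)"

definition reachable :: "nat \<Rightarrow> lattice_elt \<Rightarrow> lattice_map \<Rightarrow> lattice_map set" where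
  "reachable n d u =
     {v \<in> W_aff n. \<exists>u' e. bruhat_le n u' u \<and> chain n u' v e \<and> e \<le> d}"

definition curve_nbhd :: "nat \<Rightarrow> lattice_elt \<Rightarrow> lattice_map \<Rightarrow> lattice_map set" where
  "curve_nbhd n d u =
     {v \<in> reachable n d u. \<forall>w \<in> reachable n d u. bruhat_le n v w \<longrightarrow> w = v}"

definition roots_for :: "nat \<Rightarrow> lattice_elt \<Rightarrow> lattice_elt set" where
  "roots_for n a = {b \<in> pos_real_roots n.
     b < delta n \<and> (b \<le> delta n - a \<or> a < b \<and> form n b a = 0)}"

end

theory Submission
  imports Defs
begin

text \<open>
  Realise the affine Weyl group by affine permutations \<open>f\<close> of \<open>\<int>\<close> and a positive real root by a pair
  \<open>p < q\<close> of incongruent integers. A reflection in a root of degree \<open>a\<close> increases the number of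
  \<open>i \<le> k\<close> with \<open>f i > k\<close> by at most \<open>a\<^sub>k\<close>, so everything reachable from \<open>id\<close> in degree \<open>c + \<alpha>\<close> has
  crossing numbers at most \<open>1 + \<alpha>\<^sub>k\<close>. Conversely, look at a permutation with these bounds that
  cannot be enlarged by an exchange of two values within the bounds. The bounds are then attained,
  two arcs \<open>i \<rightarrow> f i\<close> to the right that could be joined without new crossings do not occur, and
  this leaves either \<open>p \<rightarrow> q + n\<close> as the only arc to the right (up to translation), or
  \<open>p \<rightarrow> q\<close> and \<open>x \<rightarrow> x + n\<close> with \<open>q < x < p + n\<close>. The same holds for the inverse, so the
  permutation is \<open>t\<^bsub>\<beta>\<^esub> s\<^bsub>\<alpha>\<^esub>\<close> with \<open>\<beta> = e\<^sub>x - e\<^sub>y\<close>. These elements are reachable because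
  \<open>t\<^bsub>\<beta>\<^esub> = s\<^bsub>c-\<beta>\<^esub> s\<^bsub>\<beta>\<^esub>\<close>, and they all have the same length, so all of them are maximal.
\<close>

subsection \<open>Affine permutations\<close>

text \<open>A priori the bound on crossing numbers only describes a superset of the reachable set.
  It suffices because every exchange used for climbing in it is a Bruhat step and the elements at
  the top turn out to be reachable themselves. Climbing stops: at most 2 arcs over every wall means
  displacements of at most \<open>2 * N\<close>, hence bounded length. What pins the top elements
  down is that a wall outside \<open>\<alpha>\<close> has bound 1, so no arc can pass over it
  together with one of its translates. Arcs to the left need no separate study, since crossing
  numbers are invariant under inversion. The two clauses defining the root set are the two orders of
  \<open>x\<close> and \<open>y\<close>: for \<open>x < y\<close> the root fits into
  \<open>c - \<alpha>\<close>; for \<open>x > y\<close> it is made positive by adding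
  \<open>c\<close>, and it then contains \<open>\<alpha>\<close> and is orthogonal to it. The
  distinction by \<open>\<alpha>\<^sub>0\<close> disappears, because \<open>c\<close> lies in the
  radical of the form and \<open>\<beta>\<close> and \<open>\<beta> - c\<close> give the same
  translation map.\<close>

locale modulus =
  fixes N :: int
  assumes N3: "N \<ge> 3"
begin

lemma dvd_diffE:
  assumes "N dvd i - j"
  obtains m where "i = j + m * N"
  using assms by (metis add.commute diff_add_cancel dvd_def mult.commute)

lemma small_dvd: "N dvd z \<Longrightarrow> \<bar>z\<bar> < N \<Longrightarrow> z = 0"
  using dvd_imp_le_int[of z N] N3 by linarith

lemma dvd_diff_trans: "N dvd a - b \<Longrightarrow> N dvd b - c \<Longrightarrow> N dvd a - c"
  using dvd_add[of N "a - b" "b - c"] by simp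

lemma dvd_diff_sym: "N dvd a - b \<longleftrightarrow> N dvd b - a"
  by (rule dvd_diff_commute)

lemma dvd_diff_left: "N dvd i - a \<Longrightarrow> N dvd i - b \<longleftrightarrow> N dvd a - b"
  using dvd_diff_trans[of i a b] dvd_diff_trans[of a i b] dvd_diff_sym[of i a] by blast

lemma not_dvd_1: "\<not> N dvd 1" "\<not> N dvd -1"
  using N3 small_dvd[of 1] small_dvd[of "-1"] by linarith+

definition periodic :: "(int \<Rightarrow> 'a) \<Rightarrow> bool" where
  "periodic f \<longleftrightarrow> (\<forall>i. f (i + N) = f i)"

lemma periodic_dvd:
  assumes "periodic f" "N dvd i - j"
  shows "f i = f j"
proof -
  have up: "f (j + int m * N) = f j" for m j
  proof (induction m)
    case (Suc m)
    have "j + int (Suc m) * N = j + int m * N + N" by (simp add: algebra_simps)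
    then have "f (j + int (Suc m) * N) = f (j + int m * N + N)" by (rule arg_cong)
    also have "\<dots> = f j" using Suc assms(1) unfolding periodic_def by metis
    finally show ?case .
  qed simp
  obtain k where k: "i = j + k * N"
    using assms(2) by (metis add.commute diff_add_cancel dvd_def mult.commute)
  show ?thesis
  proof (cases "k \<ge> 0")
    case True
    then show ?thesis using up[of j "nat k"] k by simp
  next
    case False
    then show ?thesis using up[of i "nat (-k)"] k by simp
  qed
qed

text \<open>Reduction mod \<open>N\<close> after \<open>g\<close> is injective on \<open>A\<close>,
  hence onto \<open>{0..<N}\<close> by cardinality, and a periodic summand does not notice
  it.\<close>

lemma sum_transversal:
  fixes f :: "int \<Rightarrow> 'a::comm_monoid_add"
  assumes f: "periodic f" and fin: "finite A" "card A = nat N"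
    and g: "\<And>i j. i \<in> A \<Longrightarrow> j \<in> A \<Longrightarrow> N dvd g i - g j \<Longrightarrow> i = j"
  shows "(\<Sum>i\<in>A. f (g i)) = (\<Sum>i\<in>{0..<N}. f i)"
proof -
  have inj: "inj_on (\<lambda>i. g i mod N) A"
    by (rule inj_onI) (meson g mod_eq_dvd_iff)
  have "(\<lambda>i. g i mod N) ` A \<subseteq> {0..<N}"
    using N3 by auto
  moreover have "card ((\<lambda>i. g i mod N) ` A) = card {0..<N}"
    using fin card_image[OF inj] by simp
  ultimately have im: "(\<lambda>i. g i mod N) ` A = {0..<N}"
    by (simp add: card_subset_eq)
  have "(\<Sum>i\<in>{0..<N}. f i) = (\<Sum>i\<in>A. f (g i mod N))"
    unfolding im[symmetric] sum.reindex[OF inj] by simp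
  also have "\<dots> = (\<Sum>i\<in>A. f (g i))"
    by (intro sum.cong refl periodic_dvd[OF f]) (simp add: dvd_diff_commute)
  finally show ?thesis by simp
qed

lemma sum_residue:
  fixes h :: "int \<Rightarrow> 'a::comm_monoid_add"
  assumes "periodic h"
  shows "(\<Sum>i\<in>{0..<N}. if N dvd i - a then h i else 0) = h a"
proof -
  have "(N dvd i - a) = (i = a mod N)" if "i \<in> {0..<N}" for i
    using that by (auto simp: mod_eq_dvd_iff[symmetric])
  then have "(\<Sum>i\<in>{0..<N}. if N dvd i - a then h i else 0)
      = (\<Sum>i\<in>{0..<N}. if i = a mod N then h i else 0)"
    by (intro sum.cong) auto
  also have "\<dots> = h (a mod N)"
    using N3 by simp
  finally show ?thesis
    using periodic_dvd[OF assms, of "a mod N" a] by (simp add: dvd_diff_commute)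
qed

lemma sum_residue_const:
  fixes h :: "'a::comm_monoid_add"
  shows "(\<Sum>i\<in>{0..<N}. if N dvd i - a then h else 0) = h"
  using sum_residue[of "\<lambda>_. h" a] by (simp add: periodic_def)

text \<open>The sum condition cuts the extended affine Weyl group, which contains the shift by 1,
  down to the Coxeter group.\<close>

definition aff :: "(int \<Rightarrow> int) set" where
  "aff = {f. bij f \<and> (\<forall>i. f (i + N) = f i + N) \<and> (\<Sum>i\<in>{0..<N}. f i - i) = 0}"

text \<open>The reflection in \<open>e_a - e_b\<close>, meant for incongruent \<open>a\<close> and
  \<open>b\<close>.\<close>

definition tr :: "int \<Rightarrow> int \<Rightarrow> int \<Rightarrow> int" where
  "tr a b i = (if N dvd i - a then i - a + b else if N dvd i - b then i - b + a else i)"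

text \<open>The translation by \<open>e_x - e_y\<close>: raising an index by \<open>N\<close>
  subtracts \<open>c\<close>.\<close>

definition tau :: "int \<Rightarrow> int \<Rightarrow> int \<Rightarrow> int" where
  "tau x y i = i + (if N dvd i - x then N else 0) - (if N dvd i - y then N else 0)"

lemma aff_bij: "f \<in> aff \<Longrightarrow> bij f"
  and aff_N: "f \<in> aff \<Longrightarrow> f (i + N) = f i + N"
  and aff_sum: "f \<in> aff \<Longrightarrow> (\<Sum>i\<in>{0..<N}. f i - i) = 0"
  by (auto simp: aff_def)

lemma aff_eq_iff: "f \<in> aff \<Longrightarrow> f i = f j \<longleftrightarrow> i = j"
  using aff_bij bij_is_inj by (metis injD)

lemma aff_inv [simp]: "f \<in> aff \<Longrightarrow> f (inv f i) = i" "f \<in> aff \<Longrightarrow> inv f (f i) = i"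
  by (simp_all add: aff_bij bij_is_surj surj_f_inv_f bij_is_inj)

lemma aff_shift:
  assumes "f \<in> aff"
  shows "f (i + k * N) = f i + k * N"
proof -
  have "periodic (\<lambda>i. f i - i)"
    using aff_N[OF assms] by (simp add: periodic_def)
  from periodic_dvd[OF this, of "i + k * N" i] show ?thesis by simp
qed

lemma aff_dvd:
  assumes "f \<in> aff"
  shows "N dvd i - j \<Longrightarrow> f i - i = f j - j"
    and "N dvd f i - f j \<longleftrightarrow> N dvd i - j"
proof -
  have *: "f i - i = f j - j" if "N dvd i - j" for i j
  proof -
    have "periodic (\<lambda>i. f i - i)"
      using aff_N[OF assms] by (simp add: periodic_def)
    from periodic_dvd[OF this that] show ?thesis by simp
  qed
  then show "N dvd i - j \<Longrightarrow> f i - i = f j - j" .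
  show "N dvd f i - f j \<longleftrightarrow> N dvd i - j"
  proof
    assume "N dvd f i - f j"
    then obtain k where "f i = f j + k * N"
      by (metis add.commute diff_add_cancel dvd_def mult.commute)
    then have "f i = f (j + k * N)"
      using aff_shift[OF assms] by simp
    then show "N dvd i - j"
      using aff_eq_iff[OF assms] by simp
  next
    assume "N dvd i - j"
    with *[OF this] show "N dvd f i - f j" by (metis add_diff_cancel_left' diff_add_cancel diff_diff_eq2)
  qed
qed

lemma sum_aff:
  fixes h :: "int \<Rightarrow> 'a::comm_monoid_add"
  assumes "f \<in> aff" "periodic h"
  shows "(\<Sum>i\<in>{0..<N}. h (f i)) = (\<Sum>i\<in>{0..<N}. h i)"
proof (rule sum_transversal[OF assms(2)])
  fix i j assume "i \<in> {0..<N}" "j \<in> {0..<N}" "N dvd f i - f j"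
  then have "N dvd i - j" "\<bar>i - j\<bar> < N"
    using aff_dvd(2)[OF assms(1)] by auto
  then show "i = j" using small_dvd by fastforce
qed simp_all

lemma aff_id: "id \<in> aff"
  by (simp add: aff_def)

lemma aff_comp:
  assumes f: "f \<in> aff" and g: "g \<in> aff"
  shows "f \<circ> g \<in> aff"
proof -
  have "periodic (\<lambda>i. f i - i)"
    using aff_N[OF f] by (simp add: periodic_def)
  from sum_aff[OF g this] have "(\<Sum>i\<in>{0..<N}. f (g i) - g i) = 0"
    using aff_sum[OF f] by simp
  moreover have "(\<Sum>i\<in>{0..<N}. f (g i) - i) = (\<Sum>i\<in>{0..<N}. f (g i) - g i) + (\<Sum>i\<in>{0..<N}. g i - i)"
    by (simp flip: sum.distrib)
  ultimately show ?thesis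
    using f g aff_sum[OF g] by (auto simp: aff_def bij_comp)
qed

lemma aff_inv_in:
  assumes f: "f \<in> aff"
  shows "inv f \<in> aff"
proof -
  have sh: "inv f (i + N) = inv f i + N" for i
    using f aff_N[OF f] by (metis aff_inv)
  then have "periodic (\<lambda>i. inv f i - i)"
    by (simp add: periodic_def)
  from sum_aff[OF f this] have "(\<Sum>i\<in>{0..<N}. inv f i - i) = (\<Sum>i\<in>{0..<N}. i - f i)"
    using f by simp
  also have "\<dots> = - (\<Sum>i\<in>{0..<N}. f i - i)"
    by (simp add: sum_subtractf)
  finally show ?thesis
    using sh f aff_sum[OF f] by (simp add: aff_def bij_imp_bij_inv)
qed

lemma tr_a: "tr a b a = b"
  and tr_b: "\<not> N dvd a - b \<Longrightarrow> tr a b b = a"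
  using dvd_diff_sym[of a b] by (auto simp: tr_def)

lemma tr_other: "\<not> N dvd i - a \<Longrightarrow> \<not> N dvd i - b \<Longrightarrow> tr a b i = i"
  by (simp add: tr_def)

lemma tr_tr:
  assumes "\<not> N dvd a - b"
  shows "tr a b (tr a b i) = i"
proof -
  have "N dvd i - a + b - a \<longleftrightarrow> N dvd b - a" if "N dvd i - a"
    using that dvd_add_right_iff[of N "i - a" "b - a"] by (simp add: add_diff_eq)
  moreover have "i - a + b - b = i - a" "i - b + a - a = i - b" by simp_all
  ultimately show ?thesis
    using assms dvd_diff_sym[of a b] by (auto simp: tr_def)
qed

lemma tr_diff:
  assumes "\<not> N dvd a - b"
  shows "tr a b i - i = (if N dvd i - a then b - a else 0) + (if N dvd i - b then a - b else 0)"
  using assms dvd_diff_left[of i a b] by (auto simp: tr_def)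

lemma tr_aff:
  assumes "\<not> N dvd a - b"
  shows "tr a b \<in> aff"
proof -
  have "bij (tr a b)"
    using tr_tr[OF assms] by (intro o_bij[of "tr a b"]) auto
  moreover have "tr a b (i + N) = tr a b i + N" for i
  proof -
    have "N dvd i + N - c \<longleftrightarrow> N dvd i - c" for c
      by (metis add_diff_eq diff_add_eq dvd_add_triv_right_iff)
    then show ?thesis by (simp add: tr_def)
  qed
  moreover have "(\<Sum>i\<in>{0..<N}. tr a b i - i) = 0"
    by (simp only: tr_diff[OF assms] sum.distrib sum_residue_const)
  ultimately show ?thesis by (simp add: aff_def)
qed

lemma tau_aff:
  shows "tau x y \<in> aff"
proof -
  have sh: "N dvd i + N - c \<longleftrightarrow> N dvd i - c" "N dvd i - N - c \<longleftrightarrow> N dvd i - c" for i c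
    by (metis add_diff_eq diff_add_eq dvd_add_triv_right_iff,
        metis diff_add_cancel diff_right_commute dvd_add_triv_right_iff)
  have "tau y x (tau x y i) = i" for x y i
    by (auto simp: tau_def sh)
  then have "bij (tau x y)"
    by (intro o_bij[of "tau y x"]) auto
  moreover have "tau x y (i + N) = tau x y i + N" for i
    by (simp add: tau_def sh)
  moreover have "(\<Sum>i\<in>{0..<N}. tau x y i - i) = 0"
  proof -
    have "tau x y i - i = (if N dvd i - x then N else 0) - (if N dvd i - y then N else 0)" for i
      by (simp add: tau_def)
    then show ?thesis
      by (simp only: sum_subtractf sum_residue_const)
  qed
  ultimately show ?thesis by (simp add: aff_def)
qed

lemma tr_conj:
  assumes "f \<in> aff"
  shows "f (tr a b i) = tr (f a) (f b) (f i)"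
proof -
  have "f (i - a + b) = f i - f a + f b" if "N dvd i - a" for a b
  proof -
    have "N dvd i - a + b - b" using that by simp
    from aff_dvd(1)[OF assms this] aff_dvd(1)[OF assms that] show ?thesis by simp
  qed
  then show ?thesis
    using aff_dvd(2)[OF assms] by (simp add: tr_def)
qed

text \<open>For \<open>0 \<le> k < N\<close>, the number of elements of \<open>k + N\<int>\<close> in \<open>[0, b)\<close>, counted negatively if \<open>b < 0\<close>.\<close>

definition cnt :: "int \<Rightarrow> int \<Rightarrow> int" where
  "cnt k b = - ((k - b) div N)"

lemma cnt_mono: "b \<le> b' \<Longrightarrow> cnt k b \<le> cnt k b'"
  using N3 by (simp add: cnt_def zdiv_mono1)

lemma cnt_shift: "cnt k (b + m * N) = cnt k b + m"
proof -
  have "k - (b + m * N) = (k - b) + (- m) * N" by simp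
  then show ?thesis
    unfolding cnt_def using N3 by (simp only: div_mult_self1)
qed

lemma cnt_shift_left: "cnt (k + m * N) b = cnt k b - m"
proof -
  have "k + m * N - b = (k - b) + m * N" by simp
  then show ?thesis
    unfolding cnt_def using N3 by (simp only: div_mult_self1)
qed

lemma div_succ: "(z + 1) div N = z div N + (if N dvd z + 1 then 1 else 0)"
proof (cases "N dvd z + 1")
  case True
  then obtain m where m: "z + 1 = m * N" by (metis dvd_def mult.commute)
  then have "z = (m - 1) * N + (N - 1)" by (simp add: algebra_simps)
  then have "z div N = m - 1"
    using N3 by (intro int_div_pos_eq[of _ _ _ "N - 1"]) (simp_all add: mult.commute)
  then show ?thesis using m N3 True by simp
next
  case False
  have z: "z = z div N * N + z mod N" by simp
  have "z mod N \<noteq> N - 1"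
  proof
    assume "z mod N = N - 1"
    then have "z + 1 = (z div N + 1) * N" using z by (simp only: distrib_right)
    then show False using False by (metis dvd_triv_right)
  qed
  then have "0 \<le> z mod N + 1" "z mod N + 1 < N"
    using N3 pos_mod_bound[of N z] pos_mod_sign[of N z] by linarith+
  moreover have "z + 1 = N * (z div N) + (z mod N + 1)" by simp
  ultimately have "(z + 1) div N = z div N" by (metis int_div_pos_eq)
  then show ?thesis using False by simp
qed

lemma cnt_succ: "cnt k (b + 1) = cnt k b + (if N dvd b - k then 1 else 0)"
  using div_succ[of "k - b - 1"] dvd_diff_sym[of k b] by (simp add: cnt_def algebra_simps)

lemma cnt_pred: "cnt (k - 1) b = cnt k b + (if N dvd b - k then 1 else 0)"
  using div_succ[of "k - b - 1"] dvd_diff_sym[of k b] by (simp add: cnt_def algebra_simps)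

subsection \<open>Crossing numbers and length\<close>

lemma cnt_pos: "1 \<le> cnt k b \<longleftrightarrow> k < b"
  and cnt_nonpos: "cnt k b \<le> 0 \<longleftrightarrow> b \<le> k"
proof -
  have "0 \<le> (k - b) div N \<longleftrightarrow> 0 \<le> k - b"
    using N3 by (intro pos_imp_zdiv_nonneg_iff) simp
  then show "cnt k b \<le> 0 \<longleftrightarrow> b \<le> k" "1 \<le> cnt k b \<longleftrightarrow> k < b"
    unfolding cnt_def by linarith+
qed

lemma cnt_aff_dvd:
  assumes "f \<in> aff" "N dvd i - j"
  shows "cnt k (f i) - cnt k i = cnt k (f j) - cnt k j"
proof -
  obtain m where "i = j + m * N" using assms(2) by (rule dvd_diffE)
  then show ?thesis using aff_shift[OF assms(1)] by (simp add: cnt_shift)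
qed

text \<open>\<open>f\<close> is drawn as the arcs from \<open>i\<close> to \<open>f i\<close>; \<open>arcs f k\<close> are those that pass from left to right
  over the wall between \<open>k\<close> and \<open>k + 1\<close>.\<close>

definition arcs :: "(int \<Rightarrow> int) \<Rightarrow> int \<Rightarrow> int set" where
  "arcs f k = {i. i \<le> k \<and> k < f i}"

text \<open>The number of arcs over wall \<open>k\<close>, split by residue classes so that an
  exchange alters two summands only.\<close>

definition cross :: "(int \<Rightarrow> int) \<Rightarrow> int \<Rightarrow> int" where
  "cross f k = (\<Sum>i\<in>{0..<N}. max 0 (cnt k (f i) - cnt k i))"

text \<open>The translate \<open>i + m * N\<close> starts at or before \<open>k\<close> iff
  \<open>cnt k i + m \<le> 0\<close>, and its arc ends after \<open>k\<close> iff
  \<open>cnt k (f i) + m \<ge> 1\<close>; the admissible \<open>m\<close> form an interval.\<close>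

lemma arcs_card:
  assumes f: "f \<in> aff"
  shows "finite (arcs f k)" and "cross f k = int (card (arcs f k))"
proof -
  define S where "S = Sigma {0..<N} (\<lambda>i. {1 - cnt k (f i) .. - cnt k i})"
  define h where "h = (\<lambda>(i, m). i + m * N)"
  have inj: "inj_on h ({0..<N} \<times> UNIV)"
  proof (rule inj_onI, clarsimp simp: h_def)
    fix i j m l assume *: "0 \<le> i" "i < N" "0 \<le> j" "j < N" "i + m * N = j + l * N"
    have "(i + m * N) mod N = i" "(j + l * N) mod N = j"
      using *(1-4) by (simp_all only: mod_mult_self1 mod_pos_pos_trivial)
    then have "i = j" using *(5) by metis
    then show "i = j \<and> m = l" using * N3 by simp
  qed
  then have inj: "inj_on h S"
    by (rule inj_on_subset) (auto simp: S_def)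
  have mem: "h (i, m) \<in> arcs f k \<longleftrightarrow> m \<in> {1 - cnt k (f i) .. - cnt k i}" for i m
    using cnt_pos[of k "f i + m * N"] cnt_nonpos[of k "i + m * N"]
    by (auto simp: arcs_def h_def aff_shift[OF f] cnt_shift)
  have "arcs f k = h ` S"
  proof
    show "arcs f k \<subseteq> h ` S"
    proof
      fix x assume "x \<in> arcs f k"
      moreover have x: "x = h (x mod N, x div N)" by (simp add: h_def)
      ultimately have "(x mod N, x div N) \<in> S"
        using mem[of "x mod N" "x div N"] N3 by (simp add: S_def)
      then show "x \<in> h ` S" using x by blast
    qed
    show "h ` S \<subseteq> arcs f k" using mem by (auto simp: S_def)
  qed
  moreover have "finite S" by (simp add: S_def)
  moreover have "int (card S) = cross f k"
    by (auto simp: S_def cross_def intro!: sum.cong)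
  ultimately show "finite (arcs f k)" "cross f k = int (card (arcs f k))"
    using card_image[OF inj] by simp_all
qed

lemma cross_ge:
  assumes "f \<in> aff" "A \<subseteq> arcs f k"
  shows "int (card A) \<le> cross f k"
  using arcs_card[OF assms(1), of k] card_mono[OF _ assms(2)] by simp

text \<open>Only the point \<open>k\<close> lies between walls \<open>k - 1\<close> and
  \<open>k\<close>: an arc to the right starting there is gained, one ending there is lost.\<close>

lemma cross_step:
  assumes f: "f \<in> aff"
  shows "cross f k = cross f (k - 1) + (if k < f k then 1 else 0) - (if inv f k < k then 1 else 0)"
proof -
  define X where "X = (if k < f k then {k} else {})"
  define Y where "Y = (if inv f k < k then {inv f k} else {})"
  have fi: "f i = k \<longleftrightarrow> i = inv f k" for i using f by auto
  have "i \<in> arcs f k \<union> Y \<longleftrightarrow> i \<in> arcs f (k - 1) \<union> X" for i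
    using fi[of i] by (cases "i = k") (auto simp: X_def Y_def arcs_def)
  then have "arcs f k \<union> Y = arcs f (k - 1) \<union> X" by blast
  moreover have "arcs f k \<inter> Y = {}" "arcs f (k - 1) \<inter> X = {}"
    using f by (auto simp: X_def Y_def arcs_def)
  ultimately have "card (arcs f k) + card Y = card (arcs f (k - 1)) + card X"
    using arcs_card(1)[OF f] by (metis card_Un_disjoint finite.simps X_def Y_def)
  then show ?thesis
    using arcs_card(2)[OF f] by (simp add: X_def Y_def split: if_splits)
qed

lemma cross_dvd:
  assumes "N dvd k - l"
  shows "cross f k = cross f l"
proof -
  obtain m where "k = l + m * N" using assms by (rule dvd_diffE)
  then show ?thesis by (simp add: cross_def cnt_shift_left)
qed

text \<open>There is no net flow over a wall: \<open>N * cnt k i - i\<close> is periodic, so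
  applying \<open>f\<close> keeps its sum, and the displacements sum to 0.\<close>

lemma sum_cnt_diff:
  assumes f: "f \<in> aff"
  shows "(\<Sum>i\<in>{0..<N}. cnt k (f i) - cnt k i) = 0"
proof -
  have "periodic (\<lambda>i. N * cnt k i - i)"
    using cnt_shift[of k _ 1] by (simp add: periodic_def algebra_simps)
  from sum_aff[OF f this]
  have "(\<Sum>i\<in>{0..<N}. (N * cnt k (f i) - f i) - (N * cnt k i - i)) = 0"
    by (simp add: sum_subtractf)
  moreover have "(N * cnt k (f i) - f i) - (N * cnt k i - i) = N * (cnt k (f i) - cnt k i) - (f i - i)" for i
    by (simp add: algebra_simps)
  ultimately have "(\<Sum>i\<in>{0..<N}. N * (cnt k (f i) - cnt k i) - (f i - i)) = 0"
    by (simp only:)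
  then have "N * (\<Sum>i\<in>{0..<N}. cnt k (f i) - cnt k i) - (\<Sum>i\<in>{0..<N}. f i - i) = 0"
    by (simp only: sum_subtractf[of "\<lambda>i. N * (cnt k (f i) - cnt k i)" "\<lambda>i. f i - i"] sum_distrib_left)
  then show ?thesis using aff_sum[OF f] N3 by simp
qed

text \<open>The arcs of the inverse to the right are those of \<open>f\<close> to the left, and
  \<open>sum_cnt_diff\<close> says that as many go left as right.\<close>

lemma cross_inv:
  assumes f: "f \<in> aff"
  shows "cross (inv f) k = cross f k"
proof -
  have "periodic (\<lambda>i. max 0 (cnt k (inv f i) - cnt k i))"
    using cnt_aff_dvd[OF aff_inv_in[OF f]] unfolding periodic_def by (metis add_diff_cancel_left' dvd_refl)
  from sum_aff[OF f this] have "cross (inv f) k = (\<Sum>i\<in>{0..<N}. max 0 (cnt k i - cnt k (f i)))"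
    using f by (simp add: cross_def)
  moreover have "max 0 (cnt k (f i) - cnt k i) - max 0 (cnt k i - cnt k (f i)) = cnt k (f i) - cnt k i" for i
    by simp
  then have "cross f k - (\<Sum>i\<in>{0..<N}. max 0 (cnt k i - cnt k (f i))) = 0"
    unfolding cross_def sum_subtractf[symmetric] using sum_cnt_diff[OF f] by presburger
  ultimately show ?thesis by simp
qed

lemma cross_tr:
  assumes f: "f \<in> aff" and ab: "\<not> N dvd a - b"
  shows "cross (f \<circ> tr a b) k = cross f k
    + (max 0 (cnt k (f b) - cnt k a) - max 0 (cnt k (f a) - cnt k a))
    + (max 0 (cnt k (f a) - cnt k b) - max 0 (cnt k (f b) - cnt k b))"
proof -
  define u v where "u = max 0 (cnt k (f b) - cnt k a) - max 0 (cnt k (f a) - cnt k a)"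
    and "v = max 0 (cnt k (f a) - cnt k b) - max 0 (cnt k (f b) - cnt k b)"
  have "max 0 (cnt k (f (tr a b i)) - cnt k i) = max 0 (cnt k (f i) - cnt k i)
      + (if N dvd i - a then u else 0) + (if N dvd i - b then v else 0)" for i
  proof -
    consider m where "i = a + m * N" | m where "i = b + m * N" | "\<not> N dvd i - a" "\<not> N dvd i - b"
      by (meson dvd_diffE)
    then show ?thesis
    proof cases
      case (1 m)
      then have "tr a b i = b + m * N" "N dvd i - a" by (simp_all add: tr_def)
      moreover have "\<not> N dvd i - b" using ab dvd_diff_left[OF \<open>N dvd i - a\<close>] by simp
      ultimately show ?thesis using 1 by (simp add: aff_shift[OF f] cnt_shift u_def)
    next
      case (2 m)
      then have "N dvd i - b" by simp
      then have "\<not> N dvd i - a" using ab dvd_diff_left dvd_diff_sym by blast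
      then have "tr a b i = a + m * N" using 2 by (simp add: tr_def)
      then show ?thesis using 2 \<open>\<not> N dvd i - a\<close> by (simp add: aff_shift[OF f] cnt_shift v_def)
    qed (simp add: tr_def)
  qed
  then show ?thesis
    by (simp only: cross_def o_apply sum.distrib sum_residue_const u_def v_def)
qed

text \<open>The link between degrees and crossing numbers: \<open>cnt k b - cnt k a\<close> is the
  coefficient at \<open>k\<close> of the root \<open>e_a - e_b\<close>. Moving a start from
  \<open>b\<close> back to \<open>a\<close> costs at most this much, and moving the other start
  forward costs nothing.\<close>

lemma cross_tr_le:
  assumes "f \<in> aff" "\<not> N dvd a - b" "a < b"
  shows "cross (f \<circ> tr a b) k \<le> cross f k + (cnt k b - cnt k a)"
  using cross_tr[OF assms(1,2), of k] cnt_mono[of a b k] assms(3) by linarith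

text \<open>Shi's formula for the length of an affine permutation: for \<open>i < j\<close> in a window of length \<open>N\<close>,
  the summand counts the inversions between the residue classes of \<open>i\<close> and \<open>j\<close>.\<close>

definition shi :: "int \<Rightarrow> (int \<Rightarrow> int) \<Rightarrow> int" where
  "shi c f = (\<Sum>i\<in>{c..<c+N}. \<Sum>j\<in>{i<..<c+N}. \<bar>(f j - f i) div N\<bar>)"

section \<open>Shi's formula under right multiplication by reflections\<close>

lemma div_neg: "\<not> N dvd u \<Longrightarrow> (- u) div N = - (u div N) - 1"
  using N3 by (simp add: zdiv_zminus1_eq_if dvd_eq_mod_eq_0)

text \<open>The pairs \<open>(c, j)\<close> are replaced by \<open>(j, c + N)\<close>. With
  \<open>d = (f j - f c) div N\<close> the new summand is the absolute value of
  \<open>(- d - 1) + 1\<close>.\<close>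

lemma shi_succ:
  assumes f: "f \<in> aff"
  shows "shi (c + 1) f = shi c f"
proof -
  define F where "F i j = \<bar>(f j - f i) div N\<bar>" for i j
  define R where "R = (\<Sum>i\<in>{c+1..<c+N}. \<Sum>j\<in>{i<..<c+N}. F i j)"
  have "{c..<c+N} = insert c {c+1..<c+N}" "{c<..<c+N} = {c+1..<c+N}"
    using N3 by auto
  then have 1: "shi c f = (\<Sum>j\<in>{c+1..<c+N}. F c j) + R"
    by (simp add: shi_def R_def F_def)
  have last: "{c+1..<c+1+N} = insert (c+N) {c+1..<c+N}" "{c+N<..<c+1+N} = {}"
    using N3 by auto
  have "(\<Sum>j\<in>{i<..<c+1+N}. F i j) = (\<Sum>j\<in>{i<..<c+N}. F i j) + F c i" if "i \<in> {c+1..<c+N}" for i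
  proof -
    have "{i<..<c+1+N} = insert (c+N) {i<..<c+N}" using that by auto
    moreover have "F i (c + N) = F c i"
    proof -
      have "\<not> N dvd i - c" using that small_dvd[of "i - c"] by auto
      then have "\<not> N dvd f i - f c" using aff_dvd(2)[OF f] by simp
      from div_neg[OF this] have "(f c - f i) div N = - ((f i - f c) div N) - 1" by simp
      moreover have "(f (c + N) - f i) div N = (f c - f i) div N + 1"
      proof -
        have "f (c + N) - f i = (f c - f i) + N" using aff_N[OF f] by simp
        then show ?thesis using N3 by (simp only: div_add_self2)
      qed
      ultimately show ?thesis by (simp add: F_def)
    qed
    ultimately show ?thesis by simp
  qed
  then have "(\<Sum>i\<in>{c+1..<c+N}. \<Sum>j\<in>{i<..<c+1+N}. F i j) = R + (\<Sum>j\<in>{c+1..<c+N}. F c j)"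
    by (simp add: R_def sum.distrib)
  moreover have "shi (c + 1) f = (\<Sum>i\<in>{c+1..<c+1+N}. \<Sum>j\<in>{i<..<c+1+N}. F i j)"
    by (simp add: shi_def F_def)
  ultimately show ?thesis using 1 last by simp
qed

lemma shi_indep:
  assumes "f \<in> aff"
  shows "shi c f = shi 0 f"
proof (induction c rule: int_induct[where k = 0])
  case (step1 i)
  then show ?case using shi_succ[OF assms, of i] by simp
next
  case (step2 i)
  then show ?case using shi_succ[OF assms, of "i - 1"] by simp
qed simp

lemma succ_not_dvd: "\<not> N dvd k - (k + 1)"
  using not_dvd_1 by simp

text \<open>In the window starting at \<open>k\<close> the exchange permutes the summands, except
  for the pair \<open>(k, k + 1)\<close>, whose quotient \<open>d\<close> becomes
  \<open>- d - 1\<close>.\<close>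

lemma shi_tr_succ:
  assumes f: "f \<in> aff"
  shows "shi 0 (f \<circ> tr k (k + 1)) = shi 0 f + (if f k < f (k + 1) then 1 else -1)"
proof -
  define s where "s = tr k (k + 1)"
  define F where "F i j = \<bar>(f j - f i) div N\<bar>" for i j
  have s: "s k = k + 1" "s (k + 1) = k" "s i = i" if "i \<in> {k+2..<k+N}" for i
    using that tr_a tr_b[OF succ_not_dvd] small_dvd[of "i - k"] small_dvd[of "i - (k + 1)"]
    by (auto simp: s_def intro!: tr_other)
  have s12: "s k = k + 1" "s (k + 1) = k"
    using tr_a tr_b[OF succ_not_dvd] by (auto simp: s_def)
  have W: "{k..<k+N} = insert k (insert (k+1) {k+2..<k+N})" "{k<..<k+N} = insert (k+1) {k+2..<k+N}"
     "{k+1<..<k+N} = {k+2..<k+N}"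
    using N3 by auto
  have exp: "shi k g = G k (k + 1) + (\<Sum>j\<in>{k+2..<k+N}. G k j) + (\<Sum>j\<in>{k+2..<k+N}. G (k + 1) j)
      + (\<Sum>i\<in>{k+2..<k+N}. \<Sum>j\<in>{i<..<k+N}. G i j)"
    if "\<And>i j. G i j = \<bar>(g j - g i) div N\<bar>" for g G
    unfolding shi_def W(1) by (simp add: W(2,3) that)
  have "shi k f = F k (k + 1) + (\<Sum>j\<in>{k+2..<k+N}. F k j) + (\<Sum>j\<in>{k+2..<k+N}. F (k + 1) j)
      + (\<Sum>i\<in>{k+2..<k+N}. \<Sum>j\<in>{i<..<k+N}. F i j)"
    by (rule exp) (simp add: F_def)
  moreover have "shi k (f \<circ> s) = F (s k) (s (k + 1)) + (\<Sum>j\<in>{k+2..<k+N}. F (s k) (s j))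
      + (\<Sum>j\<in>{k+2..<k+N}. F (s (k + 1)) (s j))
      + (\<Sum>i\<in>{k+2..<k+N}. \<Sum>j\<in>{i<..<k+N}. F (s i) (s j))"
    by (rule exp) (simp add: F_def)
  ultimately have "shi k (f \<circ> s) - shi k f = F (k + 1) k - F k (k + 1)"
    using s by (simp add: s12)
  moreover have "F (k + 1) k - F k (k + 1) = (if f k < f (k + 1) then 1 else -1)"
  proof -
    have nd: "\<not> N dvd f (k + 1) - f k" using aff_dvd(2)[OF f] not_dvd_1 by simp
    then have "(f k - f (k + 1)) div N = - ((f (k + 1) - f k) div N) - 1"
      using div_neg[OF nd] by simp
    moreover have "0 \<le> (f (k + 1) - f k) div N \<longleftrightarrow> f k \<le> f (k + 1)"
      using N3 pos_imp_zdiv_nonneg_iff[of N "f (k + 1) - f k"] by simp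
    moreover have "f k \<noteq> f (k + 1)" using nd by auto
    ultimately show ?thesis by (auto simp: F_def)
  qed
  ultimately show ?thesis
    using shi_indep[OF f, of k] shi_indep[OF aff_comp[OF f tr_aff[OF succ_not_dvd]], of k k]
    by (simp add: s_def)
qed

lemma shi_id: "shi 0 id = 0"
proof -
  have "(j - i) div N = 0" if "i \<in> {0..<N}" "j \<in> {i<..<N}" for i j
    using that N3 by (simp add: div_pos_pos_trivial)
  then show ?thesis by (simp add: shi_def)
qed

lemma shi_nonneg: "0 \<le> shi c f"
  by (simp add: shi_def sum_nonneg)

text \<open>An increasing bijection of the integers skips no value, so it is a shift, and the sum
  condition leaves only the shift by 0.\<close>

lemma aff_ascending_id:
  assumes f: "f \<in> aff" and asc: "\<And>k. f k < f (k + 1)"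
  shows "f = id"
proof -
  have up: "f i + int m \<le> f (i + int m)" for i m
  proof (induction m)
    case (Suc m)
    have "f i + int (Suc m) \<le> f (i + int m) + 1" using Suc by simp
    also have "\<dots> \<le> f (i + int m + 1)" using asc[of "i + int m"] by linarith
    also have "i + int m + 1 = i + int (Suc m)" by simp
    finally show ?case .
  qed simp
  have mono: "f i < f j" if "i < j" for i j
  proof -
    have "i + int (nat (j - i)) = j" using that by simp
    with up[of i "nat (j - i)"] have "f i + (j - i) \<le> f j" using that by simp
    then show ?thesis using that by linarith
  qed
  have succ: "f (k + 1) = f k + 1" for k
  proof (rule ccontr)
    assume "f (k + 1) \<noteq> f k + 1"
    then have "f k < f (inv f (f k + 1))" "f (inv f (f k + 1)) < f (k + 1)"
      using asc[of k] f by simp_all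
    then have "k < inv f (f k + 1)" "inv f (f k + 1) < k + 1"
      using mono by (metis linorder_neqE_linordered_idom order_less_asym)+
    then show False by simp
  qed
  have fk: "f k = f 0 + k" for k
  proof (induction k rule: int_induct[where k = 0])
    case (step1 i)
    then show ?case using succ[of i] by simp
  next
    case (step2 i)
    then show ?case using succ[of "i - 1"] by simp
  qed simp
  have "f i - i = f 0" for i using fk[of i] by linarith
  then have "f 0 = 0" using aff_sum[OF f] N3 by simp
  show ?thesis
  proof
    show "f i = id i" for i using fk[of i] \<open>f 0 = 0\<close> by simp
  qed
qed

text \<open>Conjugation by a simple reflection makes a transposition shorter.\<close>

lemma tr_succ_reduce:
  assumes "a + 1 < b" "\<not> N dvd a - b"
  obtains b' where "tr a (a + 1) b = b'" "a + 1 < b'" "b' \<le> b" "\<not> N dvd (a + 1) - b'"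
    "tr a (a + 1) b' = b" "tr a b = tr a (a + 1) \<circ> tr (a + 1) b' \<circ> tr a (a + 1)"
proof -
  define s where "s = tr a (a + 1)"
  have s: "s \<in> aff" unfolding s_def by (rule tr_aff[OF succ_not_dvd])
  have ss: "s (s i) = i" for i unfolding s_def by (rule tr_tr[OF succ_not_dvd])
  have sa: "s a = a + 1" by (simp add: s_def tr_a)
  have "s (tr a b i) = tr (a + 1) (s b) (s i)" for i
    using tr_conj[OF s] sa by simp
  then have "tr a b i = s (tr (a + 1) (s b) (s i))" for i
    by (metis ss)
  moreover have "\<not> N dvd (a + 1) - s b"
    using assms(2) aff_dvd(2)[OF s, of a b] sa by simp
  moreover have "a + 1 < s b \<and> s b \<le> b"
  proof (cases "N dvd b - (a + 1)")
    case True
    then have "s b = b - 1"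
      using assms(2) dvd_diff_sym[of a b] by (simp add: s_def tr_def)
    moreover have "\<not> b - (a + 1) < N" using True small_dvd assms(1) by fastforce
    ultimately show ?thesis using N3 by simp
  next
    case False
    then show ?thesis
      using assms dvd_diff_sym[of a b] by (simp add: s_def tr_def)
  qed
  ultimately show ?thesis
    using that[of "s b"] ss by (simp add: s_def fun_eq_iff)
qed

text \<open>Induction on \<open>b - a\<close>, writing \<open>tr a b\<close> as
  \<open>s \<circ> t \<circ> s\<close> with \<open>s\<close> simple and \<open>t\<close> of smaller
  width. Each factor \<open>s\<close> changes the length by 1; the gain from \<open>t\<close>
  absorbs a final loss if the first \<open>s\<close> was a gain.\<close>

lemma shi_tr_less:
  assumes "f \<in> aff" "a < b" "\<not> N dvd a - b" "f a < f b"
  shows "shi 0 f < shi 0 (f \<circ> tr a b)"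
  using assms
proof (induction "nat (b - a)" arbitrary: f a b rule: less_induct)
  case less
  note f = less.prems(1)
  show ?case
  proof (cases "b = a + 1")
    case True
    then show ?thesis using shi_tr_succ[OF f, of a] less.prems(4) by simp
  next
    case False
    with less.prems have "a + 1 < b" by simp
    then obtain b' where b': "tr a (a + 1) b = b'" "a + 1 < b'" "b' \<le> b" "\<not> N dvd (a + 1) - b'"
      "tr a (a + 1) b' = b" "tr a b = tr a (a + 1) \<circ> tr (a + 1) b' \<circ> tr a (a + 1)"
      using tr_succ_reduce less.prems(3) by metis
    define s where "s = tr a (a + 1)"
    define t where "t = tr (a + 1) b'"
    define g where "g = f \<circ> s"
    have s_aff: "s \<in> aff" unfolding s_def by (rule tr_aff[OF succ_not_dvd])
    have g: "g \<in> aff" unfolding g_def by (rule aff_comp[OF f s_aff])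
    have gt: "g \<circ> t \<in> aff" unfolding t_def by (rule aff_comp[OF g tr_aff[OF b'(4)]])
    have s: "s a = a + 1" "s (a + 1) = a"
      by (simp_all add: s_def tr_a tr_b[OF succ_not_dvd])
    have g_val: "g (a + 1) = f a" "g b' = f b" "g a = f (a + 1)"
      using s b'(5) by (simp_all add: g_def s_def)
    have IH: "shi 0 g < shi 0 (g \<circ> t)"
      unfolding t_def by (rule less.hyps) (use b' g g_val less.prems(4) in simp_all)
    have 1: "shi 0 g = shi 0 f + (if f a < f (a + 1) then 1 else -1)"
      unfolding g_def s_def by (rule shi_tr_succ[OF f])
    have 2: "shi 0 (f \<circ> tr a b) = shi 0 (g \<circ> t) + (if g (t a) < g (t (a + 1)) then 1 else -1)"
      using shi_tr_succ[OF gt, of a] by (simp add: g_def t_def s_def b'(6) o_assoc)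
    \<comment> \<open>If the first \<open>s\<close> was a loss, the last one must be a gain. This is
      delicate only when \<open>t\<close> also moves \<open>a\<close>, that is, when
      \<open>a\<close> and \<open>b'\<close> are congruent.\<close>
    have "g (t a) < f b" if "\<not> f a < f (a + 1)"
    proof (cases "N dvd a - b'")
      case True
      then have "t a = (a + 1) + (a - b')"
        using not_dvd_1 by (simp add: t_def tr_def)
      moreover have "N dvd (a + 1) + (a - b') - (a + 1)" using True by simp
      ultimately have "g (t a) = g (a + 1) + (a - b')"
        using aff_dvd(1)[OF g] by fastforce
      then show ?thesis using g_val less.prems(4) b'(2) by simp
    next
      case False
      then have "t a = a" using not_dvd_1 by (simp add: t_def tr_def)
      then show ?thesis using g_val less.prems(4) that by simp
    qed
    moreover have "g (t (a + 1)) = f b" by (simp add: t_def tr_a g_val)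
    ultimately show ?thesis using 1 2 IH by (auto split: if_splits)
  qed
qed

text \<open>This exhibits \<open>tr a b\<close> as a conjugate of a simple reflection, as the
  definition of Coxeter reflections demands.\<close>

lemma adjacent_preimages:
  assumes "a < b" "\<not> N dvd a - b"
  shows "\<exists>g\<in>aff. \<exists>c. g c = a \<and> g (c + 1) = b"
  using assms
proof (induction "nat (b - a)" arbitrary: a b rule: less_induct)
  case less
  show ?case
  proof (cases "b = a + 1")
    case True
    then show ?thesis using aff_id by (intro bexI[of _ id]) auto
  next
    case False
    with less.prems have "a + 1 < b" by simp
    then obtain b' where b': "tr a (a + 1) b = b'" "a + 1 < b'" "b' \<le> b" "\<not> N dvd (a + 1) - b'"
      "tr a (a + 1) b' = b"
      using tr_succ_reduce less.prems(2) by metis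
    then obtain g c where g: "g \<in> aff" "g c = a + 1" "g (c + 1) = b'"
      using less.hyps[of b' "a + 1"] by auto
    have "tr a (a + 1) \<circ> g \<in> aff" by (rule aff_comp[OF tr_aff[OF succ_not_dvd] g(1)])
    moreover have "(tr a (a + 1) \<circ> g) c = a" "(tr a (a + 1) \<circ> g) (c + 1) = b"
      using g b' tr_b[OF succ_not_dvd] by simp_all
    ultimately show ?thesis by blast
  qed
qed

lemma window_rep:
  obtains x where "N dvd x - k" "u - N < x" "x \<le> u"
proof
  show "N dvd u - (u - k) mod N - k"
  proof -
    have "u - (u - k) mod N - k = N * ((u - k) div N)"
      using mult_div_mod_eq[of N "u - k"] by linarith
    then show ?thesis by simp
  qed
  show "u - N < u - (u - k) mod N" "u - (u - k) mod N \<le> u"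
    using N3 pos_mod_bound[of N "u - k"] pos_mod_sign[of N "u - k"] by linarith+
qed

text \<open>The one representative \<open>u\<close> of the class of \<open>z\<close> in the window
  is the first member of \<open>c + N - 1 - u\<close> pairs and the second member of
  \<open>u - c\<close> pairs.\<close>

lemma sum_pairs_residue:
  "(\<Sum>i\<in>{c..<c+N}. \<Sum>j\<in>{i<..<c+N}. (if N dvd i - z then 1 else 0) + (if N dvd j - z then 1 else 0)) = N - 1"
proof -
  obtain u where u: "N dvd u - z" "c \<le> u" "u < c + N"
    using window_rep[of z "c + N - 1"] by (metis add.commute add_diff_cancel_left' add_le_cancel_left
        diff_add_cancel diff_right_commute zle_diff1_eq zless_imp_add1_zle)
  have iff: "N dvd i - z \<longleftrightarrow> i = u" if "i \<in> {c..<c+N}" for i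
  proof -
    have "N dvd i - z \<longleftrightarrow> N dvd i - u"
      using dvd_diff_left[OF u(1), of i] dvd_diff_sym by (metis dvd_diff_left)
    then show ?thesis using that u small_dvd[of "i - u"] by auto
  qed
  have "(\<Sum>j\<in>{i<..<c+N}. (if N dvd i - z then 1 else 0) + (if N dvd j - z then 1 else (0::int)))
      = (if i = u then c + N - 1 - u else 0) + (if i < u then 1 else 0)" if i: "i \<in> {c..<c+N}" for i
  proof -
    have "(\<Sum>j\<in>{i<..<c+N}. (if N dvd i - z then 1 else 0) + (if N dvd j - z then 1 else (0::int)))
        = (\<Sum>j\<in>{i<..<c+N}. (if i = u then 1 else 0) + (if j = u then 1 else 0))"
      by (intro sum.cong refl) (use i iff in auto)
    then show ?thesis using i u by (simp add: sum.distrib)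
  qed
  then have "(\<Sum>i\<in>{c..<c+N}. \<Sum>j\<in>{i<..<c+N}. (if N dvd i - z then 1 else 0) + (if N dvd j - z then 1 else (0::int)))
      = (\<Sum>i\<in>{c..<c+N}. (if i = u then c + N - 1 - u else 0) + (if i < u then 1 else 0))"
    by (rule sum.cong[OF refl])
  also have "\<dots> = (c + N - 1 - u) + (\<Sum>i\<in>{c..<c+N}. if i < u then 1 else 0)"
    using u by (simp add: sum.distrib)
  also have "(\<Sum>i\<in>{c..<c+N}. if i < u then 1 else 0) = (\<Sum>i\<in>{c..<u}. 1::int)"
    by (rule sum.mono_neutral_cong_right) (use u in auto)
  finally show ?thesis using u by simp
qed

end

section \<open>A fixed root \<open>\<alpha> = e_p - e_q\<close> below \<open>c\<close>\<close>

locale root_modulus = modulus +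
  fixes p q :: int
  assumes pq: "p < q" "q < p + N"
begin

lemma p_q: "\<not> N dvd p - q" "\<not> N dvd q - p"
  using pq small_dvd[of "p - q"] small_dvd[of "q - p"] by auto

text \<open>The coefficient of \<open>c + \<alpha>\<close> at \<open>k\<close>: it is 2 if some
  translate of \<open>k\<close> lies in \<open>{p..<q}\<close>, and 1 otherwise.\<close>

definition deg :: "int \<Rightarrow> int" where
  "deg k = 1 + cnt k q - cnt k p"

definition deg_bounded :: "(int \<Rightarrow> int) set" where
  "deg_bounded = {f \<in> aff. \<forall>k. cross f k \<le> deg k}"

text \<open>Only single length-increasing exchanges are tested, not the whole Bruhat order on
  \<open>deg_bounded\<close>; this already suffices for the classification.\<close>

definition maximal :: "(int \<Rightarrow> int) \<Rightarrow> bool" where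
  "maximal f \<longleftrightarrow> f \<in> deg_bounded \<and> (\<forall>a b. a < b \<and> \<not> N dvd a - b \<and> f a < f b \<longrightarrow> f \<circ> tr a b \<notin> deg_bounded)"

lemma deg_step: "deg k = deg (k - 1) + (if N dvd k - p then 1 else 0) - (if N dvd k - q then 1 else 0)"
  using cnt_pred[of k p] cnt_pred[of k q] by (auto simp: deg_def dvd_diff_commute)

lemma deg_bounds: "1 \<le> deg k" "deg k \<le> 2"
  using cnt_mono[of p q k] cnt_mono[of q "p + N" k] cnt_shift[of k p 1] pq by (simp_all add: deg_def)

lemma deg_q: "deg q = 1"
  using cnt_nonpos[of q q] cnt_nonpos[of q p] cnt_pos[of q "p + N"] cnt_pos[of q "q + N"]
    cnt_shift[of q p 1] cnt_shift[of q q 1] pq N3 by (simp add: deg_def)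

lemma deg_dvd: "N dvd k - l \<Longrightarrow> deg k = deg l"
  by (metis dvd_diffE deg_def cnt_shift_left diff_diff_eq2 add_diff_cancel_right' diff_add_eq diff_right_commute)

text \<open>In the window from \<open>p\<close>, which \<open>s\<close> preserves, every quotient is
  0 or -1. The translation adds 1 to its absolute value for each member of a pair in the class of
  \<open>x\<close> or \<open>y\<close>, without cancellation, and each class occurs in
  \<open>N - 1\<close> pairs.\<close>

lemma tau_tr_shi:
  assumes xy: "q \<le> x" "x < p + N" "q < y" "y \<le> p + N" "x \<noteq> y"
  shows "shi 0 (tau x y \<circ> tr p q) = shi 0 (tr p q) + 2 * (N - 1)"
proof -
  define s where "s = tr p q"
  define \<chi> :: "int \<Rightarrow> int \<Rightarrow> int" where "\<chi> z i = (if N dvd i - z then 1 else 0)" for z i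
  have s: "s \<in> aff" unfolding s_def by (rule tr_aff[OF p_q(1)])
  have ss: "s (s i) = i" for i unfolding s_def by (rule tr_tr[OF p_q(1)])
  have sval: "s i = (if i = p then q else if i = q then p else i)" if "p \<le> i" "i < p + N" for i
  proof -
    have "\<bar>i - p\<bar> < N" "\<bar>i - q\<bar> < N" using that pq by linarith+
    then have "N dvd i - p \<Longrightarrow> i = p" "N dvd i - q \<Longrightarrow> i = q"
      using small_dvd by fastforce+
    then show ?thesis using tr_a tr_b[OF p_q(1)] by (auto simp: s_def intro: tr_other)
  qed
  have \<chi>x: "\<chi> x (s i) = (if s i = x then 1 else 0)" if "p \<le> i" "i < p + N" for i
    using that xy pq small_dvd[of "s i - x"] by (auto simp: \<chi>_def sval split: if_splits)
  \<comment> \<open>The value \<open>y = p + N\<close> lies just outside the window, where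
    \<open>p\<close> represents its class.\<close>
  have \<chi>y: "\<chi> y (s i) = (if s i = y \<or> y = p + N \<and> s i = p then 1 else 0)" if i: "p \<le> i" "i < p + N" for i
  proof (cases "y = p + N")
    case True
    have "N dvd s i - y \<longleftrightarrow> N dvd s i - p" unfolding True by (metis diff_diff_eq dvd_diff_right_iff dvd_refl dvd_def diff_diff_eq2 dvd_add_triv_right_iff diff_add_cancel)
    then show ?thesis using i True pq small_dvd[of "s i - p"] by (auto simp: \<chi>_def sval split: if_splits)
  next
    case False
    then show ?thesis using i xy pq small_dvd[of "s i - y"] by (auto simp: \<chi>_def sval split: if_splits)
  qed
  have pair: "\<bar>(tau x y (s j) - tau x y (s i)) div N\<bar>
      = \<bar>(s j - s i) div N\<bar> + (\<chi> x (s i) + \<chi> x (s j)) + (\<chi> y (s i) + \<chi> y (s j))"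
    if ij: "p \<le> i" "i < j" "j < p + N" for i j
  proof -
    have "tau x y (s j) - tau x y (s i) = (s j - s i) + (\<chi> x (s j) - \<chi> x (s i) - \<chi> y (s j) + \<chi> y (s i)) * N"
      by (simp add: tau_def \<chi>_def)
    then have div: "(tau x y (s j) - tau x y (s i)) div N
        = (s j - s i) div N + (\<chi> x (s j) - \<chi> x (s i) - \<chi> y (s j) + \<chi> y (s i))"
      using N3 by simp
    have "-N \<le> s j - s i" "s j - s i < N"
      using ij pq by (auto simp: sval)
    then have d: "(s j - s i) div N = (if s i \<le> s j then 0 else -1)"
      using N3 int_div_pos_eq[of "s j - s i" N "-1" "s j - s i + N"] by (auto simp: div_pos_pos_trivial)
    have inj: "s i \<noteq> s j" using aff_eq_iff[OF s] ij by simp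
    define A B C D where "A \<longleftrightarrow> s i = x" and "B \<longleftrightarrow> s j = x"
      and "C \<longleftrightarrow> s i = y \<or> y = p + N \<and> s i = p" and "D \<longleftrightarrow> s j = y \<or> y = p + N \<and> s j = p"
    \<comment> \<open>On an inverted pair the quotient is -1, so a positive contribution, from
      \<open>x\<close> as second or \<open>y\<close> as first value, would cancel. The ranges of
      \<open>x\<close> and \<open>y\<close> prevent it.\<close>
    have "B \<Longrightarrow> s i \<le> s j"
      using ij xy pq by (auto simp: B_def sval split: if_splits)
    moreover have "C \<Longrightarrow> s i \<le> s j"
      using ij xy pq by (auto simp: C_def sval split: if_splits)
    moreover have "s i < p + N" "s j < p + N" using ij pq by (auto simp: sval)
    then have "\<not> (A \<and> B)" "\<not> (C \<and> D)" "\<not> (A \<and> C)" "\<not> (B \<and> D)"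
      using inj xy pq by (auto simp: A_def B_def C_def D_def)
    moreover have "\<chi> x (s i) = (if A then 1 else 0)" "\<chi> x (s j) = (if B then 1 else 0)"
      "\<chi> y (s i) = (if C then 1 else 0)" "\<chi> y (s j) = (if D then 1 else 0)"
      using ij \<chi>x \<chi>y by (simp_all add: A_def B_def C_def D_def)
    ultimately show ?thesis
      unfolding div d by (cases A; cases B; cases C; cases D) auto
  qed
  have sum\<chi>: "(\<Sum>i\<in>{p..<p+N}. \<Sum>j\<in>{i<..<p+N}. \<chi> z (s i) + \<chi> z (s j)) = N - 1" for z
  proof -
    have "\<chi> z (s i) = (if N dvd i - s z then 1 else 0)" for i
      using aff_dvd(2)[OF s, of i "s z"] ss by (simp add: \<chi>_def)
    then show ?thesis using sum_pairs_residue[where c = p and z = "s z"] by simp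
  qed
  have "shi p (tau x y \<circ> s) = (\<Sum>i\<in>{p..<p+N}. \<Sum>j\<in>{i<..<p+N}.
      \<bar>(s j - s i) div N\<bar> + (\<chi> x (s i) + \<chi> x (s j)) + (\<chi> y (s i) + \<chi> y (s j)))"
    unfolding shi_def o_def by (intro sum.cong refl) (simp add: pair)
  also have "\<dots> = shi p s + (\<Sum>i\<in>{p..<p+N}. \<Sum>j\<in>{i<..<p+N}. \<chi> x (s i) + \<chi> x (s j))
     + (\<Sum>i\<in>{p..<p+N}. \<Sum>j\<in>{i<..<p+N}. \<chi> y (s i) + \<chi> y (s j))"
    unfolding shi_def by (simp only: sum.distrib)
  finally have "shi p (tau x y \<circ> s) = shi p s + 2 * (N - 1)"
    unfolding sum\<chi> by simp
  then show ?thesis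
    using shi_indep[OF s, of p] shi_indep[OF aff_comp[OF tau_aff s], of p] by (simp add: s_def)
qed

subsection \<open>Maximal permutations with bounded crossing numbers\<close>

lemma maximal_aff: "maximal f \<Longrightarrow> f \<in> aff"
  and maximal_cross_le: "maximal f \<Longrightarrow> cross f k \<le> deg k"
  by (auto simp: maximal_def deg_bounded_def)

lemma deg_bounded_inv: "f \<in> deg_bounded \<Longrightarrow> inv f \<in> deg_bounded"
  by (simp add: deg_bounded_def aff_inv_in cross_inv)

text \<open>The inverse of \<open>inv f \<circ> tr a b\<close> is
  \<open>f \<circ> tr (inv f a) (inv f b)\<close>, again an exchange of an increasing pair. So
  results on arcs to the right transfer to arcs to the left.\<close>

lemma maximal_inv:
  assumes m: "maximal f"
  shows "maximal (inv f)"
  unfolding maximal_def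
proof (intro conjI allI impI notI)
  note f = maximal_aff[OF m]
  note g = aff_inv_in[OF f]
  show "inv f \<in> deg_bounded" using m deg_bounded_inv by (simp add: maximal_def)
  fix a b
  assume *: "a < b \<and> \<not> N dvd a - b \<and> inv f a < inv f b" and deg_bounded: "inv f \<circ> tr a b \<in> deg_bounded"
  have eq: "inv (inv f \<circ> tr a b) = f \<circ> tr (inv f a) (inv f b)"
  proof (rule inv_unique_comp)
    show "(inv f \<circ> tr a b) \<circ> (f \<circ> tr (inv f a) (inv f b)) = id"
      using tr_conj[OF f, of "inv f a" "inv f b"] f tr_tr[of a b] * by (simp add: fun_eq_iff)
    show "(f \<circ> tr (inv f a) (inv f b)) \<circ> (inv f \<circ> tr a b) = id"
      using tr_conj[OF f, of "inv f a" "inv f b"] f tr_tr[of a b] * by (simp add: fun_eq_iff)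
  qed
  have "\<not> N dvd inv f a - inv f b" using aff_dvd(2)[OF g] * by simp
  moreover have "f (inv f a) < f (inv f b)" using f * by simp
  ultimately have "f \<circ> tr (inv f a) (inv f b) \<notin> deg_bounded"
    using m * unfolding maximal_def by blast
  then show False using deg_bounded_inv[OF deg_bounded] eq by simp
qed

text \<open>Exchanging disjoint arcs does not change the number of arcs above any point.\<close>

lemma maximal_no_gap:
  assumes m: "maximal f" and ab: "a < b" "\<not> N dvd a - b" "f a < f b"
  shows "f a < b" "a < f b"
proof -
  note f = maximal_aff[OF m]
  have nX: "f \<circ> tr a b \<notin> deg_bounded" using m ab unfolding maximal_def by blast
  have fX: "f \<circ> tr a b \<in> aff" by (rule aff_comp[OF f tr_aff[OF ab(2)]])
  have mono: "cnt k a \<le> cnt k b" "cnt k (f a) \<le> cnt k (f b)" for k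
    using ab by (simp_all add: cnt_mono)
  have eq: "cross (f \<circ> tr a b) k = cross f k" if "b \<le> f a \<or> f b \<le> a" for k
  proof -
    have "cnt k b \<le> cnt k (f a) \<or> cnt k (f b) \<le> cnt k a"
      using that cnt_mono by blast
    then show ?thesis
      using cross_tr[OF f ab(2), of k] mono[of k] by (auto simp: max_def)
  qed
  have "f \<circ> tr a b \<in> deg_bounded" if "b \<le> f a \<or> f b \<le> a"
    using eq[OF that] fX maximal_cross_le[OF m] by (simp add: deg_bounded_def)
  then show "f a < b" "a < f b" using nX by linarith+
qed

text \<open>Exchanging neighbours \<open>k\<close> and \<open>k + 1\<close> costs at most 1 at wall
  \<open>k\<close>, up to translation, and nothing elsewhere; slack at an ascent would permit
  it.\<close>

lemma maximal_ascent:
  assumes m: "maximal f" and asc: "f k < f (k + 1)"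
  shows "cross f k = deg k"
proof (rule ccontr)
  note f = maximal_aff[OF m]
  assume "cross f k \<noteq> deg k"
  then have less: "cross f k < deg k" using maximal_cross_le[OF m, of k] by simp
  have "cross (f \<circ> tr k (k + 1)) l \<le> deg l" for l
  proof (cases "N dvd k - l")
    case True
    then show ?thesis
      using cross_tr_le[OF f succ_not_dvd, of k l] cnt_succ[of l k] cross_dvd[OF True, of f] deg_dvd[OF True] less
      by simp
  next
    case False
    then show ?thesis
      using cross_tr_le[OF f succ_not_dvd, of k l] cnt_succ[of l k] maximal_cross_le[OF m, of l]
      by simp
  qed
  then have "f \<circ> tr k (k + 1) \<in> deg_bounded"
    using aff_comp[OF f tr_aff[OF succ_not_dvd]] by (simp add: deg_bounded_def)
  moreover have "k < k + 1" by simp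
  ultimately show False using m asc succ_not_dvd unfolding maximal_def by blast
qed

text \<open>An empty wall has slack, hence a descent. Then either \<open>k\<close> starts an arc
  over it, or \<open>f (k + 1) \<le> f k \<le> k\<close> gives an arc of the inverse over
  it.\<close>

lemma maximal_cross_pos:
  assumes m: "maximal f"
  shows "1 \<le> cross f k"
proof (rule ccontr)
  note f = maximal_aff[OF m]
  note g = aff_inv_in[OF f]
  assume n: "\<not> 1 \<le> cross f k"
  then have "cross f k \<noteq> deg k" using deg_bounds[of k] by simp
  then have desc: "f (k + 1) \<le> f k" using maximal_ascent[OF m, of k] by linarith
  show False
  proof (cases "k < f k")
    case True
    then show False using cross_ge[OF f, of "{k}" k] n by (simp add: arcs_def)
  next
    case False
    then have "{f (k + 1)} \<subseteq> arcs (inv f) k" using desc f by (simp add: arcs_def)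
    then show False using cross_ge[OF g, of "{f (k + 1)}" k] cross_inv[OF f, of k] n by simp
  qed
qed

text \<open>Wall \<open>k - 1\<close> is not empty, so an arc from the left must end at
  \<open>k\<close>. The arc ending at \<open>k + 1\<close> starts even earlier and passes wall
  \<open>k\<close> beside the one from \<open>k\<close>.\<close>

lemma maximal_descent_start:
  assumes m: "maximal f" and k: "cross f k = 1" "k < f k" "inv f (k + 1) < inv f k"
  shows False
proof -
  note f = maximal_aff[OF m]
  have "inv f k < k"
    using cross_step[OF f, of k] maximal_cross_pos[OF m, of "k - 1"] k by (simp split: if_splits)
  then have "{k, inv f (k + 1)} \<subseteq> arcs f k" "inv f (k + 1) \<noteq> k"
    using k f by (auto simp: arcs_def)
  then show False using cross_ge[OF f, of "{k, inv f (k + 1)}" k] k by simp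
qed

text \<open>If the bound is not attained at \<open>k\<close>, then by \<open>maximal_ascent\<close> both \<open>f\<close> and its
  inverse have a descent at \<open>k\<close>; but then a neighbouring wall is crossed by no arc.\<close>

lemma maximal_cross:
  assumes m: "maximal f"
  shows "cross f k = deg k"
proof (rule ccontr)
  note f = maximal_aff[OF m]
  note g = aff_inv_in[OF f]
  assume n: "cross f k \<noteq> deg k"
  then have 1: "cross f k = 1" "cross (inv f) k = 1"
    using maximal_cross_le[OF m, of k] maximal_cross_pos[OF m, of k] deg_bounds[of k] cross_inv[OF f]
    by simp_all
  have "f (k + 1) \<noteq> f k" "inv f (k + 1) \<noteq> inv f k"
    using aff_eq_iff[OF f] aff_eq_iff[OF g] by simp_all
  then have desc: "f (k + 1) < f k" "inv f (k + 1) < inv f k"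
    using maximal_ascent[OF m, of k] maximal_ascent[OF maximal_inv[OF m], of k] n cross_inv[OF f, of k]
    by linarith+
  have inv_inv: "inv (inv f) = f" by (rule inv_inv_eq[OF aff_bij[OF f]])
  have "f k \<le> k"
    using maximal_descent_start[OF m 1(1)] desc by force
  moreover have "inv f k \<le> k"
    using maximal_descent_start[OF maximal_inv[OF m] 1(2)] desc inv_inv by fastforce
  ultimately have "cross f (k + 1) = 0"
    using desc cross_step[OF f, of "k + 1"] 1 by simp
  then show False using maximal_cross_pos[OF m, of "k + 1"] by simp
qed

text \<open>Compares the increments of \<open>cross\<close> and \<open>deg\<close>. Up to
  translation, \<open>p\<close> starts an arc to the right and receives none from the left,
  \<open>q\<close> does the opposite, and any other point starts one iff it receives one.\<close>

lemma maximal_balance: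
  assumes m: "maximal f"
  shows "(if k < f k then 1 else 0) - (if inv f k < k then 1 else 0)
    = (if N dvd k - p then 1 else 0) - (if N dvd k - q then 1 else (0::int))"
  using cross_step[OF maximal_aff[OF m], of k] deg_step[of k] maximal_cross[OF m] by simp

text \<open>Wall \<open>q\<close> lies just outside \<open>\<alpha>\<close>, where the bound is 1.
  Applied to an arc and its translate, this excludes arcs of length \<open>2 * N\<close> or
  more.\<close>

lemma maximal_arc_q:
  assumes m: "maximal f" and "i \<le> q" "q < f i" "j \<le> q" "q < f j"
  shows "i = j"
proof (rule ccontr)
  assume "i \<noteq> j"
  then have "2 \<le> cross f q"
    using cross_ge[OF maximal_aff[OF m], of "{i, j}" q] assms by (simp add: arcs_def)
  then show False using maximal_cross[OF m] deg_q by simp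
qed

text \<open>By balance an arc from the left also ends at \<open>k\<close>. Arcs meeting at
  \<open>k\<close> contradict \<open>maximal_no_gap\<close> unless they are translates of each
  other, so \<open>f k\<close> is congruent to \<open>k\<close>; wall \<open>q\<close> then bounds
  the length.\<close>

lemma maximal_start:
  assumes m: "maximal f" and k: "k < f k" "\<not> N dvd k - p"
  shows "f k = k + N" "\<not> N dvd k - q"
proof -
  note f = maximal_aff[OF m]
  have *: "inv f k < k" "\<not> N dvd k - q"
    using maximal_balance[OF m, of k] k by (auto split: if_splits)
  then show "\<not> N dvd k - q" by simp
  have "N dvd inv f k - k"
  proof (rule ccontr)
    assume "\<not> N dvd inv f k - k"
    then show False using maximal_no_gap(1)[OF m *(1)] f k by simp
  qed
  then have "N dvd f (inv f k) - f k" using aff_dvd(2)[OF f] by simp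
  then have "N dvd f k - k" using f dvd_diff_sym by simp
  then obtain c where c: "f k = k + c * N" by (rule dvd_diffE)
  have "c \<ge> 1"
  proof (rule ccontr)
    assume "\<not> c \<ge> 1"
    then have "c * N \<le> 0" using N3 by (simp add: mult_nonpos_nonneg)
    then show False using c k by simp
  qed
  moreover have "c \<le> 1"
  proof (rule ccontr)
    assume "\<not> c \<le> 1"
    then have cN: "2 * N \<le> c * N" using N3 by (intro mult_right_mono) simp_all
    obtain x where x: "N dvd x - k" "q - N < x" "x \<le> q" using window_rep .
    then have fx: "f x = x + c * N" using aff_dvd(1)[OF f x(1)] c by simp
    then have "f (x - N) = x - N + c * N" using aff_shift[OF f, of x "-1"] by simp
    then have "x = x - N"
      by (intro maximal_arc_q[OF m]) (use x fx cN N3 in linarith)+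
    then show False using N3 by simp
  qed
  ultimately show "f k = k + N" using c by simp
qed

lemma maximal_p: "maximal f \<Longrightarrow> p < f p" "maximal f \<Longrightarrow> p \<le> inv f p"
  using maximal_balance[of f p] p_q by (auto split: if_splits)

text \<open>If the arc from \<open>p\<close> ended outside the class of \<open>q\<close>, balance
  would let another arc start at its end, against \<open>maximal_no_gap\<close>. It cannot end in
  the class of \<open>p\<close>, which receives no arc from the left.\<close>

lemma maximal_target_p:
  assumes m: "maximal f"
  shows "f p = q \<or> f p = q + N"
proof -
  note f = maximal_aff[OF m]
  have "N dvd f p - q"
  proof (rule ccontr)
    assume nq: "\<not> N dvd f p - q"
    have np: "\<not> N dvd f p - p"
    proof
      assume "N dvd f p - p"
      from aff_dvd(1)[OF aff_inv_in[OF f] this] f have "p - f p = inv f p - p" by simp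
      then show False using maximal_p[OF m] by simp
    qed
    have "f p < f (f p)"
      using maximal_balance[OF m, of "f p"] nq np maximal_p[OF m] f by (simp split: if_splits)
    then show False
      using maximal_no_gap(1)[OF m, of p "f p"] maximal_p[OF m] np dvd_diff_sym[of p "f p"] by simp
  qed
  then obtain c where c: "f p = q + c * N" by (rule dvd_diffE)
  have "c \<ge> 0"
  proof (rule ccontr)
    assume "\<not> c \<ge> 0"
    then have "c * N \<le> (-1) * N" using N3 by (intro mult_right_mono) simp_all
    then show False using c maximal_p[OF m] pq by simp
  qed
  moreover have "c \<le> 1"
  proof (rule ccontr)
    assume "\<not> c \<le> 1"
    then have cN: "2 * N \<le> c * N" using N3 by (intro mult_right_mono) simp_all
    have "f (p - N) = f p - N" using aff_shift[OF f, of p "-1"] by simp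
    then have "p = p - N"
      by (intro maximal_arc_q[OF m]) (use c cN N3 pq in linarith)+
    then show False using N3 by simp
  qed
  ultimately have "c = 0 \<or> c = 1" by auto
  then show ?thesis using c by auto
qed

text \<open>The value \<open>x = q\<close> encodes the case of the single arc from \<open>p\<close>
  to \<open>q + N\<close>. Any arc outside the class of \<open>p\<close> has length
  \<open>N\<close>, so one of its translates passes wall \<open>q\<close>, where there is room for
  one arc only.\<close>

lemma maximal_right_arcs:
  assumes m: "maximal f"
  obtains x where "q \<le> x" "x < p + N" "f p = (if x = q then q + N else q)"
    "x \<noteq> q \<Longrightarrow> f x = x + N"
    "\<And>k. k < f k \<Longrightarrow> N dvd k - p \<or> x \<noteq> q \<and> N dvd k - x"
proof -
  note f = maximal_aff[OF m]
  have over: "\<exists>k'. N dvd k' - k \<and> k' \<le> q \<and> q < f k'" if k: "k < f k" "\<not> N dvd k - p" for k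
  proof -
    obtain k' where k': "N dvd k' - k" "q - N < k'" "k' \<le> q" using window_rep .
    then have "f k' = k' + N" using aff_dvd(1)[OF f k'(1)] maximal_start(1)[OF m k] by simp
    then show ?thesis using k' by auto
  qed
  consider "f p = q + N" | "f p = q" using maximal_target_p[OF m] by blast
  then show ?thesis
  proof cases
    case 1
    have "N dvd k - p" if k: "k < f k" for k
    proof (rule ccontr)
      assume np: "\<not> N dvd k - p"
      then obtain k' where k': "N dvd k' - k" "k' \<le> q" "q < f k'" using over[OF k] by blast
      then have "k' = p" using 1 pq N3 by (intro maximal_arc_q[OF m]) simp_all
      then show False using k'(1) np dvd_diff_sym by blast
    qed
    then show ?thesis using that[of q] 1 pq by simp
  next
    case 2
    have "arcs f q \<noteq> {}"
      using arcs_card(2)[OF f, of q] maximal_cross[OF m, of q] deg_q by auto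
    then obtain a where a: "a \<le> q" "q < f a" by (auto simp: arcs_def)
    \<comment> \<open>The translates of the arc from \<open>p\<close> to \<open>q\<close> pass only
      over walls of \<open>\<alpha>\<close>, so the arc over wall \<open>q\<close> belongs to
      another class.\<close>
    have ap: "\<not> N dvd a - p"
    proof
      assume "N dvd a - p"
      then obtain c where c: "a = p + c * N" by (rule dvd_diffE)
      then have "f a = q + c * N" using 2 aff_shift[OF f] by simp
      then have "0 < c * N" using a by simp
      then have "1 \<le> c" using N3 by (simp add: zero_less_mult_iff)
      then have "1 * N \<le> c * N" using N3 by (intro mult_right_mono) simp_all
      then show False using c a pq by linarith
    qed
    have fa: "f a = a + N" "\<not> N dvd a - q" using maximal_start[OF m] a ap by auto
    obtain x where x: "N dvd x - a" "p + N - 1 - N < x" "x \<le> p + N - 1" using window_rep .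
    have fx: "f x = x + N" using aff_dvd(1)[OF f x(1)] fa by simp
    have xpq: "\<not> N dvd x - p" "\<not> N dvd x - q"
      using ap fa(2) dvd_diff_left[OF x(1)] dvd_diff_sym by (metis dvd_diff_left)+
    then have "x \<noteq> p" "x \<noteq> q" by auto
    then have px: "p < x" using x by simp
    have "\<not> N dvd p - x" using xpq dvd_diff_sym by blast
    \<comment> \<open>For \<open>x \<le> q\<close> the arcs from \<open>p\<close> and
      \<open>x\<close> would overlap or meet.\<close>
    then have "q < x"
      using maximal_no_gap(1)[OF m px] 2 fx px pq N3 \<open>x \<noteq> q\<close> by auto
    moreover have "N dvd k - p \<or> N dvd k - x" if k: "k < f k" for k
    proof (rule ccontr)
      assume n: "\<not> (N dvd k - p \<or> N dvd k - x)"
      obtain k' where k': "N dvd k' - k" "k' \<le> q" "q < f k'" using over[OF k] n by blast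
      have "k' = a" using k' a by (intro maximal_arc_q[OF m])
      then show False using k'(1) x(1) n dvd_diff_trans dvd_diff_sym by blast
    qed
    ultimately show ?thesis using that[of x] 2 x fx by simp
  qed
qed

text \<open>Here \<open>x\<close> records the arcs of \<open>f\<close> to the right and
  \<open>z\<close> those of its inverse. A point outside all these classes can be moved neither
  right nor left.\<close>

lemma maximal_classification:
  assumes m: "maximal f"
  obtains x y where "q \<le> x" "x < p + N" "q < y" "y \<le> p + N" "x \<noteq> y" "f = tau x y \<circ> tr p q"
proof -
  note f = maximal_aff[OF m]
  note g = aff_inv_in[OF f]
  obtain x where x: "q \<le> x" "x < p + N" "f p = (if x = q then q + N else q)"
    "x \<noteq> q \<Longrightarrow> f x = x + N"
    "\<And>k. k < f k \<Longrightarrow> N dvd k - p \<or> x \<noteq> q \<and> N dvd k - x"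
    by (rule maximal_right_arcs[OF m]) blast
  obtain z where z: "q \<le> z" "z < p + N" "inv f p = (if z = q then q + N else q)"
    "z \<noteq> q \<Longrightarrow> inv f z = z + N"
    "\<And>k. k < inv f k \<Longrightarrow> N dvd k - p \<or> z \<noteq> q \<and> N dvd k - z"
    by (rule maximal_right_arcs[OF maximal_inv[OF m]]) blast
  have fq: "f q = (if z = q then p - N else p)"
    using z(3) f aff_shift[OF f, of q 1] by (smt (verit) aff_inv(1) mult_1)
  have fz: "f z = z - N" if "z \<noteq> q"
    using z(4)[OF that] f aff_shift[OF f, of z 1] by (smt (verit) aff_inv(1) mult_1)
  \<comment> \<open>For \<open>z = q\<close> the only arc to the left is \<open>q\<close> to
    \<open>p - N\<close>: the translation lowers the class of \<open>p\<close>, represented by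
    \<open>p + N\<close> to stay right of \<open>q\<close>.\<close>
  define y where "y = (if z = q then p + N else z)"
  have y: "q < y" "y \<le> p + N" using z pq by (auto simp: y_def)
  have xy: "x \<noteq> y" using x(2,4) fz N3 by (auto simp: y_def split: if_splits)
  have win: "N dvd i - j \<longleftrightarrow> i = j" if "p \<le> i" "i < p + N" "p \<le> j" "j < p + N" for i j
    using that small_dvd[of "i - j"] by auto
  have yN: "N dvd i - y \<longleftrightarrow> (if z = q then N dvd i - p else N dvd i - z)" for i
    using dvd_diff_left[of "p + N" p i] dvd_diff_sym[of i] by (simp add: y_def)
  define v where "v = tau x y \<circ> tr p q"
  have v: "v \<in> aff" unfolding v_def by (rule aff_comp[OF tau_aff tr_aff[OF p_q(1)]])
  have vp: "v p = f p" and vq: "v q = f q"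
    using x(1-3) z(1,2) fq pq by (auto simp: v_def tr_a tr_b[OF p_q(1)] tau_def win yN)
  have vx: "v x = f x" if "x \<noteq> q"
    using x(1,2,4) z(1,2) xy pq that
    by (auto simp: v_def tr_other tau_def win yN) (auto simp: y_def)
  have vz: "v z = f z" if "z \<noteq> q"
    using x(1,2) z(1,2) fz xy pq that
    by (auto simp: v_def tr_other tau_def win yN) (auto simp: y_def)
  have dvd: "v i = f i" if "N dvd i - j" "v j = f j" for i j
    using aff_dvd(1)[OF v that(1)] aff_dvd(1)[OF f that(1)] that(2) by simp
  have "v i = f i" for i
  proof (cases "N dvd i - p \<or> N dvd i - q \<or> (x \<noteq> q \<and> N dvd i - x) \<or> (z \<noteq> q \<and> N dvd i - z)")
    case True
    then show ?thesis using dvd vp vq vx vz by blast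
  next
    case False
    then have n: "\<not> N dvd i - p" "\<not> N dvd i - q" "\<not> N dvd i - x" "\<not> N dvd i - z" by auto
    have "\<not> i < f i" using x(5)[of i] n by blast
    moreover have "\<not> f i < i"
    proof
      assume "f i < i"
      then have "N dvd f i - p \<or> z \<noteq> q \<and> N dvd f i - z" using z(5)[of "f i"] f by simp
      then show False
      proof
        assume "N dvd f i - p"
        then have "N dvd i - inv f p" using aff_dvd(2)[OF g, of "f i" p] f by simp
        moreover have "N dvd inv f p - q" using z(3) by simp
        ultimately show False using n dvd_diff_trans by blast
      next
        assume *: "z \<noteq> q \<and> N dvd f i - z"
        then have "N dvd i - inv f z" using aff_dvd(2)[OF g, of "f i" z] f by simp
        moreover have "N dvd inv f z - z" using z(4) * by simp
        ultimately show False using n dvd_diff_trans by blast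
      qed
    qed
    ultimately have "f i = i" by simp
    moreover have "v i = i"
      using n by (simp add: v_def tr_other tau_def yN)
    ultimately show ?thesis by simp
  qed
  then show ?thesis
    using that[of x y] x(1,2) y xy by (auto simp: v_def fun_eq_iff)
qed

text \<open>A longer arc and two of its translates would pass over one wall, but no bound exceeds
  2.\<close>

lemma deg_bounded_displacement:
  assumes "f \<in> deg_bounded"
  shows "f i \<le> i + 2 * N"
proof (rule ccontr)
  assume n: "\<not> f i \<le> i + 2 * N"
  have f: "f \<in> aff" using assms by (simp add: deg_bounded_def)
  have "{i, i + N, i + 2 * N} \<subseteq> arcs f (i + 2 * N)"
    using n N3 aff_shift[OF f, of i 1] aff_shift[OF f, of i 2] by (simp add: arcs_def)
  moreover have "card {i, i + N, i + 2 * N} = 3" using N3 by simp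
  ultimately have "3 \<le> cross f (i + 2 * N)" using cross_ge[OF f, of "{i, i + N, i + 2 * N}" "i + 2 * N"] by simp
  moreover have "cross f (i + 2 * N) \<le> deg (i + 2 * N)" using assms by (simp add: deg_bounded_def)
  ultimately show False using deg_bounds(2)[of "i + 2 * N"] by linarith
qed

text \<open>Two displacements of at most \<open>2 * N\<close> and a distance below \<open>N\<close>
  inside the window keep \<open>f j - f i\<close> within \<open>5 * N\<close>. The bound is crude
  and serves termination only.\<close>

lemma deg_bounded_shi_bound:
  assumes deg_bounded: "f \<in> deg_bounded"
  shows "shi 0 f \<le> 5 * N * N"
proof -
  have f: "f \<in> aff" using assms by (simp add: deg_bounded_def)
  have "i \<le> f i + 2 * N" for i
    using deg_bounded_displacement[OF deg_bounded_inv[OF deg_bounded], of "f i"] f by simp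
  then have disp: "f i \<le> i + 2 * N" "i \<le> f i + 2 * N" for i
    using deg_bounded_displacement[OF deg_bounded] by simp_all
  have pair: "\<bar>(f j - f i) div N\<bar> \<le> 5" if "0 \<le> i" "i < j" "j < N" for i j
  proof -
    have "-5 * N \<le> f j - f i" "f j - f i \<le> 5 * N"
      using disp[of i] disp[of j] that by linarith+
    then have "(-5 * N) div N \<le> (f j - f i) div N" "(f j - f i) div N \<le> (5 * N) div N"
      using N3 by (intro zdiv_mono1; simp)+
    moreover have "(-5 * N) div N = -5" "(5 * N) div N = 5"
      using N3 by (simp_all only: nonzero_mult_div_cancel_right)
    ultimately show ?thesis by linarith
  qed
  have "(\<Sum>j\<in>{i<..<N}. \<bar>(f j - f i) div N\<bar>) \<le> 5 * N" if i: "i \<in> {0..<N}" for i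
  proof -
    have "(\<Sum>j\<in>{i<..<N}. \<bar>(f j - f i) div N\<bar>) \<le> of_nat (card {i<..<N}) * 5"
      by (rule sum_bounded_above) (use pair i in auto)
    also have "\<dots> \<le> 5 * N" using i by simp
    finally show ?thesis .
  qed
  then have "shi 0 f \<le> of_nat (card {0..<N}) * (5 * N)"
    unfolding shi_def add_0 by (rule sum_bounded_above)
  then show ?thesis using N3 by simp
qed

definition up :: "(int \<Rightarrow> int) \<Rightarrow> (int \<Rightarrow> int) \<Rightarrow> bool" where
  "up f g \<longleftrightarrow> f \<in> aff \<and> (\<exists>a b. a < b \<and> \<not> N dvd a - b \<and> f a < f b \<and> g = f \<circ> tr a b)"

lemma below_maximal:
  assumes "f \<in> deg_bounded"
  shows "\<exists>g. maximal g \<and> up\<^sup>*\<^sup>* f g"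
  using assms
proof (induction "nat (5 * N * N - shi 0 f)" arbitrary: f rule: less_induct)
  case less
  show ?case
  proof (cases "maximal f")
    case True
    then show ?thesis by blast
  next
    case False
    then obtain a b where ab: "a < b" "\<not> N dvd a - b" "f a < f b" and deg_bounded: "f \<circ> tr a b \<in> deg_bounded"
      using less.prems unfolding maximal_def by blast
    have f: "f \<in> aff" using less.prems by (simp add: deg_bounded_def)
    have "nat (5 * N * N - shi 0 (f \<circ> tr a b)) < nat (5 * N * N - shi 0 f)"
      using shi_tr_less[OF f ab] deg_bounded_shi_bound[OF deg_bounded] by linarith
    from less.hyps[OF this deg_bounded] obtain g where "maximal g" "up\<^sup>*\<^sup>* (f \<circ> tr a b) g" by blast
    moreover have "up f (f \<circ> tr a b)" using f ab unfolding up_def by blast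
    ultimately show ?thesis by (meson converse_rtranclp_into_rtranclp)
  qed
qed

end

subsection \<open>The action on the root lattice\<close>

locale affine_A =
  fixes n :: nat
  assumes n3: "n \<ge> 3"

sublocale affine_A \<subseteq> modulus "int n"
  by unfold_locales (use n3 in simp)

context affine_A
begin

text \<open>\<open>rt a b\<close> is \<open>e\<^sub>a - e\<^sub>b\<close>, where the \<open>e\<^sub>a\<close> (\<open>a \<in> \<int>\<close>) satisfy \<open>\<alpha>\<^sub>i = e\<^sub>i - e\<^bsub>i+1\<^esub>\<close> and
  \<open>e\<^bsub>a+n\<^esub> = e\<^sub>a - \<delta>\<close>; \<open>pre b\<close> is \<open>e\<^sub>0 - e\<^sub>b\<close>, and \<open>ecoeff x a\<close> is the coefficient of \<open>x\<close> at the
  residue class of \<open>e\<^sub>a\<close> modulo \<open>\<delta>\<close>.\<close>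

definition pre :: "int \<Rightarrow> lattice_elt" where
  "pre b = (\<lambda>j. if j < n then cnt (int j) b else 0)"

definition rt :: "int \<Rightarrow> int \<Rightarrow> lattice_elt" where
  "rt a b = pre b - pre a"

definition ecoeff :: "lattice_elt \<Rightarrow> int \<Rightarrow> int" where
  "ecoeff x a = x (nat (a mod int n)) - x (nat ((a - 1) mod int n))"

text \<open>The linear map sending \<open>e_i\<close> to \<open>e_(f i)\<close> and fixing
  \<open>\<delta>\<close>. Written with the differences \<open>rt i (f i)\<close> it stays in the
  root lattice and, like \<open>root_refl\<close>, leaves coefficients from \<open>n\<close> on
  alone.\<close>

definition act :: "(int \<Rightarrow> int) \<Rightarrow> lattice_map" where
  "act f x = (\<lambda>j. x j - (\<Sum>i\<in>{0..<int n}. ecoeff x i * rt i (f i) j))"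

lemma n0: "0 < n" using n3 by simp

lemma rt_add: "rt a b + rt b c = rt a c" and rt_self: "rt a a = 0" and rt_minus: "- rt a b = rt b a"
  by (simp_all add: rt_def)

lemma rt_apply: "rt a b j = (if j < n then cnt (int j) b - cnt (int j) a else 0)"
  by (simp add: rt_def pre_def)

lemma rt_shift: "rt (a + m * int n) (b + m * int n) = rt a b"
  by (simp add: fun_eq_iff rt_apply cnt_shift)

lemma rt_mono: "c \<le> a \<Longrightarrow> b \<le> d \<Longrightarrow> rt a b \<le> rt c d"
  by (auto simp: le_fun_def rt_apply intro!: diff_mono cnt_mono)

lemma simple_root_rt:
  assumes "k < n"
  shows "simple_root k = rt (int k) (int k + 1)"
proof
  fix j
  have "int n dvd int k - int j \<longleftrightarrow> j = k" if "j < n"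
    using that assms small_dvd[of "int k - int j"] by auto
  then show "simple_root k j = rt (int k) (int k + 1) j"
    using assms by (auto simp: simple_root_def rt_apply cnt_succ)
qed

lemma sum_simple_roots: "i \<le> j \<Longrightarrow> j \<le> n \<Longrightarrow> (\<Sum>k=i..<j. simple_root k) = rt (int i) (int j)"
proof (induction j rule: dec_induct)
  case (step j)
  then show ?case using rt_add[of "int i" "int j" "int j + 1"] simple_root_rt[of j] by (simp add: add.commute)
qed (simp add: rt_self)

lemma delta_rt: "delta n = rt a (a + int n)"
proof -
  have "delta n = rt 0 (int n)"
    using sum_simple_roots[of 0 n] by (simp add: delta_def atLeast0LessThan)
  moreover have "cnt k (b + int n) = cnt k b + 1" for k b
    using cnt_shift[of k b 1] by simp
  from this[of _ a] this[of _ 0] have "rt 0 (int n) = rt a (a + int n)"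
    by (simp add: fun_eq_iff rt_apply)
  ultimately show ?thesis by simp
qed

lemma delta_apply: "delta n j = (if j < n then 1 else 0)"
  using cnt_shift[of _ 0 1] by (simp add: delta_rt[of 0] rt_apply)

lemma rt_delta: "rt a b + smul m (delta n) = rt a (b + m * int n)"
  by (simp add: fun_eq_iff rt_apply smul_def delta_apply cnt_shift)

lemma sum_lessThan_int: "(\<Sum>j<n. F (int j)) = (\<Sum>i\<in>{0..<int n}. F i)"
  by (rule sum.reindex_bij_witness[of _ nat int]) auto

text \<open>Every integer between \<open>a\<close> and \<open>b\<close> is counted by exactly one
  residue class.\<close>

lemma height_rt: "(\<Sum>j<n. rt a b j) = b - a"
proof -
  have "(\<Sum>i\<in>{0..<int n}. cnt i b) = b" for b
  proof (induction b rule: int_induct[where k = 0])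
    case base
    have "cnt i 0 = 0" if "i \<in> {0..<int n}" for i
      using that by (simp add: cnt_def div_pos_pos_trivial)
    then show ?case by simp
  next
    case (step1 b)
    then show ?case
      using sum_residue_const[of b 1] dvd_diff_sym[of b] by (simp add: cnt_succ sum.distrib)
  next
    case (step2 b)
    have "cnt i b = cnt i (b - 1) + (if int n dvd i - (b - 1) then 1 else 0)" for i
      using cnt_succ[of i "b - 1"] dvd_diff_sym[of "b - 1" i] by simp
    then have "(\<Sum>i\<in>{0..<int n}. cnt i b) = (\<Sum>i\<in>{0..<int n}. cnt i (b - 1)) + 1"
      by (simp only: sum.distrib sum_residue_const)
    then show ?case using step2.IH by linarith
  qed
  then show ?thesis
    using sum_lessThan_int[of "\<lambda>i. cnt i b"] sum_lessThan_int[of "\<lambda>i. cnt i a"]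
    by (simp add: rt_apply sum_subtractf)
qed

lemma ecoeff_periodic: "periodic (ecoeff x)"
proof -
  have "i + int n - 1 = (i - 1) + int n" for i by simp
  then show ?thesis unfolding periodic_def ecoeff_def by (simp only: mod_add_self2) simp
qed

lemma ecoeff_rt: "ecoeff (rt a b) i = (if int n dvd a - i then 1 else 0) - (if int n dvd b - i then 1 else 0)"
proof -
  define r where "r = i mod int n"
  have r: "0 \<le> r" "r < int n" using n0 by (simp_all add: r_def)
  have ri: "int n dvd r - i" unfolding r_def by (simp add: mod_eq_dvd_iff[symmetric])
  have dvd: "int n dvd c - r \<longleftrightarrow> int n dvd c - i" for c
    using dvd_diff_left[OF ri, of c] dvd_diff_sym by metis
  \<comment> \<open>At \<open>r = 0\<close> the preceding index wraps around to
    \<open>n - 1\<close>, which costs 1 independently of \<open>c\<close> and so cancels in the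
    difference \<open>rt a b\<close>.\<close>
  have cnt_prev: "cnt ((i - 1) mod int n) c = cnt r c + (if int n dvd c - i then 1 else 0) - (if r = 0 then 1 else 0)" for c
  proof (cases "r = 0")
    case True
    have "(i - 1) mod int n = (r - 1) mod int n" unfolding r_def by (simp add: mod_diff_left_eq)
    also have "\<dots> = int n - 1" using True n0 by (simp add: zmod_minus1)
    finally show ?thesis
      using True cnt_pred[of r c] cnt_shift_left[of "-1" 1 c] dvd[of c] by simp
  next
    case False
    have "(i - 1) mod int n = (r - 1) mod int n" unfolding r_def by (simp add: mod_diff_left_eq)
    also have "\<dots> = r - 1" using False r by (simp add: mod_pos_pos_trivial)
    finally show ?thesis
      using False cnt_pred[of r c] dvd[of c] by simp
  qed
  have lt: "nat r < n" "nat ((i - 1) mod int n) < n" using r n0 by (simp_all add: nat_less_iff)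
  then show ?thesis
    using r n0 by (simp add: ecoeff_def rt_apply cnt_prev r_def[symmetric])
qed

section \<open>The form and the action in the coordinates \<open>e_a\<close>\<close>

lemma form_commute: "form n x y = form n y x"
proof -
  have "cartan n i j = cartan n j i" for i j by (auto simp: cartan_def)
  then show ?thesis unfolding form_def by (subst sum.swap) (simp add: mult_ac)
qed

lemma form_add: "form n x (y + z) = form n x y + form n x z"
  and form_diff: "form n x (y - z) = form n x y - form n x z"
  by (simp_all add: form_def algebra_simps sum.distrib sum_subtractf)

lemma form_simple_root:
  assumes k: "k < n"
  shows "form n x (simple_root k) = ecoeff x (int k) - ecoeff x (int k + 1)"
proof -
  have "form n x (simple_root k) = (\<Sum>i<n. x i * cartan n i k)"
    using k by (simp add: form_def simple_root_def if_distrib[of "\<lambda>z. _ * z"] if_distrib[of "\<lambda>z. z * _"] cong: if_cong)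
  also have "\<dots> = (\<Sum>i<n. (if i = k then 2 * x i else 0) - (if i = (k + n - 1) mod n then x i else 0)
      - (if i = (k + 1) mod n then x i else 0))"
  proof (rule sum.cong[OF refl])
    fix i assume "i \<in> {..<n}"
    then have i: "i < n" by simp
    define u v where "u = (k + n - 1) mod n" and "v = (k + 1) mod n"
    have u: "u = (if k = 0 then n - 1 else k - 1)"
    proof (cases "k = 0")
      case False
      then have "k + n - 1 = (k - 1) + n" by simp
      then have "u = (k - 1) mod n" by (simp only: u_def mod_add_self2)
      then show ?thesis using False k by simp
    qed (use n0 in \<open>simp add: u_def\<close>)
    have succ: "(l + 1) mod n = (if l = n - 1 then 0 else l + 1)" if "l < n" for l
      using that by (cases "l = n - 1") simp_all
    have v: "v = (if k = n - 1 then 0 else k + 1)" unfolding v_def by (rule succ[OF k])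
    have "k = (i + 1) mod n \<longleftrightarrow> i = u"
      unfolding succ[OF i] u using i k by (cases "i = n - 1"; cases "k = 0") auto
    \<comment> \<open>For \<open>n = 2\<close> the two neighbours \<open>u\<close> and
      \<open>v\<close> would coincide.\<close>
    moreover have "k \<noteq> u" "k \<noteq> v" "u \<noteq> v" unfolding u v using k n3 by (auto split: if_splits)
    ultimately show "x i * cartan n i k = (if i = k then 2 * x i else 0) - (if i = (k + n - 1) mod n then x i else 0)
      - (if i = (k + 1) mod n then x i else 0)"
      unfolding cartan_def u_def[symmetric] v_def[symmetric] by auto
  qed
  also have "\<dots> = 2 * x k - x ((k + n - 1) mod n) - x ((k + 1) mod n)"
    using k by (simp add: sum_subtractf)
  also have "\<dots> = ecoeff x (int k) - ecoeff x (int k + 1)"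
  proof -
    have "nat ((int k - 1) mod int n) = (k + n - 1) mod n"
    proof -
      have "(int k - 1) mod int n = (int k - 1 + int n) mod int n" by simp
      also have "int k - 1 + int n = int (k + n - 1)" using n0 by simp
      finally show ?thesis by (simp flip: of_nat_mod)
    qed
    moreover have "nat ((int k + 1) mod int n) = (k + 1) mod n"
      by (metis nat_int of_nat_1 of_nat_add of_nat_mod)
    ultimately show ?thesis using k by (simp add: ecoeff_def)
  qed
  finally show ?thesis .
qed

lemma form_rt: "form n x (rt a b) = ecoeff x a - ecoeff x b"
proof -
  have step: "form n x (rt c (c + 1)) = ecoeff x c - ecoeff x (c + 1)" for c
  proof -
    define r where "r = c mod int n"
    have r: "nat r < n" "int (nat r) = r" using n0 by (simp_all add: r_def nat_less_iff)
    have dvd: "int n dvd c - r" "int n dvd (c + 1) - (r + 1)"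
      unfolding r_def by (simp_all add: mod_eq_dvd_iff[symmetric])
    obtain m where "c = r + m * int n" using dvd(1) by (rule dvd_diffE)
    then have "rt c (c + 1) = rt r (r + 1)" using rt_shift[of r m "r + 1"] by (simp add: algebra_simps)
    then show ?thesis
      using form_simple_root[OF r(1)] simple_root_rt[OF r(1)] periodic_dvd[OF ecoeff_periodic dvd(1)]
        periodic_dvd[OF ecoeff_periodic dvd(2)] r(2) by simp
  qed
  show ?thesis
  proof (induction b rule: int_induct[where k = a])
    case base
    then show ?case by (simp add: rt_self form_def)
  next
    case (step1 b)
    then show ?case using step[of b] form_add[of x "rt a b" "rt b (b + 1)"] by (simp add: rt_add)
  next
    case (step2 b)
    then show ?case using step[of "b - 1"] form_add[of x "rt a (b - 1)" "rt (b - 1) b"] by (simp add: rt_add)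
  qed
qed

lemma form_delta: "form n x (delta n) = 0"
  using form_rt[of x 0 "int n"] periodic_dvd[OF ecoeff_periodic, of "int n" 0] by (simp add: delta_rt[of 0])

lemma sum_ecoeff_residue: "(\<Sum>i\<in>{0..<int n}. ecoeff x i * (if int n dvd i - a then u else 0)) = ecoeff x a * u"
proof -
  have "periodic (\<lambda>i. ecoeff x i * u)" using ecoeff_periodic[of x] by (simp add: periodic_def)
  from sum_residue[OF this, of a] show ?thesis
    by (simp add: if_distrib[of "\<lambda>z. _ * z"] cong: if_cong)
qed

lemma rt_aff_dvd:
  assumes "f \<in> aff" "int n dvd i - j"
  shows "rt i (f i) = rt j (f j)"
  using cnt_aff_dvd[OF assms] by (auto simp: fun_eq_iff rt_apply)

lemma rt_aff_periodic:
  assumes "f \<in> aff"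
  shows "rt (i + int n) (f (i + int n)) = rt i (f i)"
  by (rule rt_aff_dvd[OF assms]) simp

lemma ecoeff_act:
  assumes f: "f \<in> aff"
  shows "ecoeff (act f x) i = ecoeff x (inv f i)"
proof -
  have 1: "ecoeff (act f x) i = ecoeff x i - (\<Sum>k\<in>{0..<int n}. ecoeff x k * ecoeff (rt k (f k)) i)"
    by (simp add: ecoeff_def act_def right_diff_distrib sum_subtractf)
  have "ecoeff (rt k (f k)) i = (if int n dvd k - i then 1 else 0) - (if int n dvd k - inv f i then 1 else 0)" for k
    using aff_dvd(2)[OF f, of k "inv f i"] f by (simp add: ecoeff_rt)
  then have "(\<Sum>k\<in>{0..<int n}. ecoeff x k * ecoeff (rt k (f k)) i) = ecoeff x i - ecoeff x (inv f i)"
    using sum_ecoeff_residue[of x i 1] sum_ecoeff_residue[of x "inv f i" 1]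
    by (simp only: right_diff_distrib sum_subtractf)
  then show ?thesis using 1 by simp
qed

text \<open>Reindexing the outer sum by \<open>g\<close> turns the composition into the telescoping
  \<open>rt k (g k) + rt (g k) (f (g k))\<close>.\<close>

lemma act_comp:
  assumes f: "f \<in> aff" and g: "g \<in> aff"
  shows "act (f \<circ> g) = act f \<circ> act g"
proof (intro ext)
  fix x j
  have "periodic (\<lambda>i. ecoeff x (inv g i) * rt i (f i) j)"
  proof -
    have "ecoeff x (inv g (i + int n)) = ecoeff x (inv g i)" for i
      using periodic_dvd[OF ecoeff_periodic] aff_dvd(2)[OF aff_inv_in[OF g], of "i + int n" i] by simp
    then show ?thesis using rt_aff_periodic[OF f] by (simp add: periodic_def)
  qed
  from sum_aff[OF g this]
  have "(\<Sum>i\<in>{0..<int n}. ecoeff (act g x) i * rt i (f i) j) = (\<Sum>k\<in>{0..<int n}. ecoeff x k * rt (g k) (f (g k)) j)"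
    using g by (simp add: ecoeff_act)
  then have "(act f \<circ> act g) x j = x j - (\<Sum>k\<in>{0..<int n}. ecoeff x k * rt k (g k) j)
      - (\<Sum>k\<in>{0..<int n}. ecoeff x k * rt (g k) (f (g k)) j)"
    by (simp add: act_def)
  also have "\<dots> = x j - (\<Sum>k\<in>{0..<int n}. ecoeff x k * (rt k (g k) j + rt (g k) (f (g k)) j))"
    by (simp add: distrib_left sum.distrib)
  also have "\<dots> = act (f \<circ> g) x j"
    using rt_add by (simp add: act_def plus_fun_def fun_eq_iff)
  finally show "act (f \<circ> g) x j = (act f \<circ> act g) x j" by simp
qed

lemma act_id: "act id = id"
  by (simp add: act_def rt_self fun_eq_iff)

lemma act_inv:
  assumes "f \<in> aff"
  shows "inv (act f) = act (inv f)"
proof (rule inv_unique_comp)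
  have "f \<circ> inv f = id" "inv f \<circ> f = id" using assms by (simp_all add: fun_eq_iff)
  then show "act f \<circ> act (inv f) = id" "act (inv f) \<circ> act f = id"
    using act_comp[OF assms aff_inv_in[OF assms]] act_comp[OF aff_inv_in[OF assms] assms] act_id by simp_all
qed

text \<open>Testing on \<open>rt k (k + 1)\<close> shows that \<open>rt k (h k)\<close> does not
  depend on \<open>k\<close>. By heights the displacement is constant, and the sum condition makes
  it 0.\<close>

lemma act_id_imp:
  assumes h: "h \<in> aff" and id: "act h = id"
  shows "h = id"
proof -
  have disp: "h i - i = (\<Sum>j<n. rt i (h i) j)" for i by (simp add: height_rt)
  have "rt k (h k) = rt (k + 1) (h (k + 1))" for k
  proof
    fix j
    have ecoeff: "ecoeff (rt k (k + 1)) i = (if int n dvd i - k then 1 else 0) - (if int n dvd i - (k + 1) then 1 else 0)" for i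
      by (simp add: ecoeff_rt dvd_diff_sym[of i])
    have per: "periodic (\<lambda>i. rt i (h i) j)"
      using rt_aff_periodic[OF h] by (simp add: periodic_def)
    have "act h (rt k (k + 1)) j = rt k (k + 1) j - (rt k (h k) j - rt (k + 1) (h (k + 1)) j)"
      using sum_residue[OF per, of k] sum_residue[OF per, of "k + 1"]
      by (simp add: act_def ecoeff left_diff_distrib sum_subtractf if_distrib[of "\<lambda>z. z * _"] cong: if_cong)
    then show "rt k (h k) j = rt (k + 1) (h (k + 1)) j" by (simp add: id)
  qed
  then have succ: "h (k + 1) - (k + 1) = h k - k" for k using disp by metis
  have const: "h k - k = h 0" for k
  proof (induction k rule: int_induct[where k = 0])
    case (step1 i)
    then show ?case using succ[of i] by simp
  next
    case (step2 i)
    then show ?case using succ[of "i - 1"] by simp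
  qed simp
  then have "h 0 = 0" using aff_sum[OF h] n0 by simp
  with const show ?thesis by (simp add: fun_eq_iff)
qed

lemma act_inj:
  assumes f: "f \<in> aff" and g: "g \<in> aff" and eq: "act f = act g"
  shows "f = g"
proof -
  note gi = aff_inv_in[OF g]
  have "act (inv g \<circ> f) = act (inv g \<circ> g)"
    unfolding act_comp[OF gi f] act_comp[OF gi g] eq ..
  also have "inv g \<circ> g = id" using g by (simp add: fun_eq_iff)
  also have "act id = id" by (rule act_id)
  finally have "inv g \<circ> f = id" by (rule act_id_imp[OF aff_comp[OF gi f]])
  then show ?thesis using g by (metis aff_inv(1) comp_apply ext id_apply)
qed

lemma act_tr:
  assumes ab: "\<not> int n dvd a - b"
  shows "act (tr a b) = root_refl n (rt a b)"
proof (intro ext)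
  fix x j
  have "rt i (tr a b i) j = (if int n dvd i - a then rt a b j else 0) + (if int n dvd i - b then rt b a j else 0)" for i
  proof -
    consider "int n dvd i - a" "\<not> int n dvd i - b" | "int n dvd i - b" "\<not> int n dvd i - a"
      | "\<not> int n dvd i - a" "\<not> int n dvd i - b"
      using ab dvd_diff_left by blast
    then show ?thesis
    proof cases
      case 1
      then show ?thesis using rt_aff_dvd[OF tr_aff[OF ab] 1(1)] by (simp add: tr_a)
    next
      case 2
      then show ?thesis using rt_aff_dvd[OF tr_aff[OF ab] 2(1)] by (simp add: tr_b[OF ab])
    qed (simp add: tr_other rt_self)
  qed
  moreover have "rt b a j = - rt a b j" by (simp add: rt_apply)
  ultimately have "(\<Sum>i\<in>{0..<int n}. ecoeff x i * rt i (tr a b i) j) = ecoeff x a * rt a b j - ecoeff x b * rt a b j"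
    by (simp add: distrib_left sum.distrib sum_ecoeff_residue)
  then show "act (tr a b) x j = root_refl n (rt a b) x j"
    by (simp add: act_def root_refl_def smul_def form_rt left_diff_distrib)
qed

lemma act_tau: "act (tau a b) = transl n (rt a b)"
proof (intro ext)
  fix x j
  have "cnt k (i + (if A then int n else 0) - (if B then int n else 0)) = cnt k i + (if A then 1 else 0) - (if B then 1 else 0)"
    for k i A B
    using cnt_shift[of k i 1] cnt_shift[of k i "-1"] by simp
  then have "rt i (tau a b i) j = (if int n dvd i - a then delta n j else 0) + (if int n dvd i - b then - delta n j else 0)" for i
    by (simp add: rt_apply tau_def delta_apply)
  then have "(\<Sum>i\<in>{0..<int n}. ecoeff x i * rt i (tau a b i) j) = ecoeff x a * delta n j - ecoeff x b * delta n j"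
    by (simp add: distrib_left sum.distrib sum_ecoeff_residue)
  then show "act (tau a b) x j = transl n (rt a b) x j"
    by (simp add: act_def transl_def smul_def form_commute[of "rt a b"] form_rt left_diff_distrib)
qed

lemma transl_minus_delta: "transl n (\<beta> - delta n) = transl n \<beta>"
  by (simp add: transl_def form_commute[of "\<beta> - delta n"] form_commute[of \<beta>] form_diff form_delta)

section \<open>Words, Coxeter length and Coxeter reflections\<close>

definition wprod :: "nat list \<Rightarrow> int \<Rightarrow> int" where
  "wprod ws = foldr (\<lambda>i w. tr (int i) (int i + 1) \<circ> w) ws id"

lemma wprod_simps: "wprod [] = id" "wprod (i # ws) = tr (int i) (int i + 1) \<circ> wprod ws"
  by (simp_all add: wprod_def)

lemma wprod_snoc: "wprod (ws @ [i]) = wprod ws \<circ> tr (int i) (int i + 1)"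
  by (induction "ws") (simp_all add: wprod_simps o_assoc)

lemma wprod_aff: "wprod ws \<in> aff"
proof (induction ws)
  case Nil
  show ?case unfolding wprod_simps by (rule aff_id)
next
  case (Cons i ws)
  show ?case unfolding wprod_simps by (rule aff_comp[OF tr_aff[OF succ_not_dvd] Cons])
qed

lemma act_wprod: "set ws \<subseteq> {..<n} \<Longrightarrow> act (wprod ws) = word_prod n ws"
proof (induction ws)
  case Nil
  show ?case unfolding wprod_simps act_id by (simp add: word_prod_def)
next
  case (Cons i ws)
  then have i: "i < n" and IH: "act (wprod ws) = word_prod n ws" by simp_all
  have "word_prod n (i # ws) = root_refl n (simple_root i) \<circ> word_prod n ws"
    by (simp add: word_prod_def)
  then show ?case
    unfolding wprod_simps act_comp[OF tr_aff[OF succ_not_dvd] wprod_aff] act_tr[OF succ_not_dvd] IH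
      simple_root_rt[OF i] by simp
qed

lemma shi_wprod: "shi 0 (wprod ws) \<le> int (length ws)"
proof (induction ws rule: rev_induct)
  case Nil
  show ?case unfolding wprod_simps shi_id by simp
next
  case (snoc i ws)
  then show ?case unfolding wprod_snoc shi_tr_succ[OF wprod_aff] by simp
qed

lemma tr_shift: "tr (a + m * int n) (b + m * int n) = tr a b"
proof
  fix i
  have "int n dvd i - (c + m * int n) \<longleftrightarrow> int n dvd i - c" for c
    using dvd_diff_left[of "c + m * int n" c i] dvd_diff_sym[of i] by simp
  then show "tr (a + m * int n) (b + m * int n) i = tr a b i" by (simp add: tr_def)
qed

lemma tr_succ_mod: "tr k (k + 1) = tr (int (nat (k mod int n))) (int (nat (k mod int n)) + 1)"
proof -
  have "k = k mod int n + (k div int n) * int n" by simp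
  then show ?thesis using tr_shift[of "k mod int n" "k div int n" "k mod int n + 1"] n0
    by (simp add: algebra_simps)
qed

text \<open>Multiplying by a simple reflection at a descent lowers \<open>shi\<close> by 1, and only
  \<open>id\<close> has no descent. Together with \<open>shi_wprod\<close> this identifies
  \<open>shi\<close> with the length.\<close>

lemma reduced_word:
  assumes "f \<in> aff"
  shows "\<exists>ws. set ws \<subseteq> {..<n} \<and> length ws = nat (shi 0 f) \<and> wprod ws = f"
  using assms
proof (induction "nat (shi 0 f)" arbitrary: f rule: less_induct)
  case less
  note f = less.prems
  show ?case
  proof (cases "\<forall>k. f k < f (k + 1)")
    case True
    then have "f = id" using aff_ascending_id[OF f] by blast
    then show ?thesis by (intro exI[of _ "[]"]) (simp add: wprod_simps shi_id)
  next
    case False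
    then obtain k where k: "\<not> f k < f (k + 1)" by blast
    define s where "s = tr k (k + 1)"
    have s: "s \<in> aff" unfolding s_def by (rule tr_aff[OF succ_not_dvd])
    have fs: "shi 0 (f \<circ> s) = shi 0 f - 1" using shi_tr_succ[OF f, of k] k by (simp add: s_def)
    then have "nat (shi 0 (f \<circ> s)) < nat (shi 0 f)" "nat (shi 0 f) = Suc (nat (shi 0 (f \<circ> s)))"
      using shi_nonneg[of 0 "f \<circ> s"] by simp_all
    then obtain "ws" where ws: "set ws \<subseteq> {..<n}" "length ws = nat (shi 0 (f \<circ> s))" "wprod ws = f \<circ> s"
      using less.hyps[OF _ aff_comp[OF f s]] by blast
    define i where "i = nat (k mod int n)"
    have "wprod (ws @ [i]) = f \<circ> s \<circ> s"
      using ws(3) tr_succ_mod[of k] by (simp add: wprod_snoc s_def i_def)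
    also have "\<dots> = f" using tr_tr[OF succ_not_dvd] by (simp add: s_def fun_eq_iff)
    finally have "wprod (ws @ [i]) = f" .
    moreover have "i < n" using n0 by (simp add: i_def nat_less_iff)
    ultimately show ?thesis
      using ws \<open>nat (shi 0 f) = _\<close> by (intro exI[of _ "ws @ [i]"]) simp
  qed
qed

lemma W_aff_act: "W_aff n = act ` aff"
proof
  show "W_aff n \<subseteq> act ` aff"
  proof
    fix w assume "w \<in> W_aff n"
    then obtain ws where "w = word_prod n ws" "set ws \<subseteq> {..<n}" by (auto simp: W_aff_def)
    then have "w = act (wprod ws)" using act_wprod by simp
    then show "w \<in> act ` aff" using wprod_aff by blast
  qed
  show "act ` aff \<subseteq> W_aff n"
  proof clarify
    fix f assume "f \<in> aff"
    then obtain ws where "set ws \<subseteq> {..<n}" "wprod ws = f" using reduced_word by blast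
    then show "act f \<in> W_aff n" using act_wprod[of ws] unfolding W_aff_def by auto
  qed
qed

lemma len_act:
  assumes f: "f \<in> aff"
  shows "len n (act f) = nat (shi 0 f)"
  unfolding len_def
proof (rule Least_equality)
  show "\<exists>ws. set ws \<subseteq> {..<n} \<and> length ws = nat (shi 0 f) \<and> word_prod n ws = act f"
    using reduced_word[OF f] act_wprod by metis
  fix k assume "\<exists>ws. set ws \<subseteq> {..<n} \<and> length ws = k \<and> word_prod n ws = act f"
  then obtain "ws" where ws: "set ws \<subseteq> {..<n}" "length ws = k" "word_prod n ws = act f" by blast
  then have "wprod ws = f" using act_inj[OF wprod_aff f] act_wprod by metis
  then show "nat (shi 0 f) \<le> k" using shi_wprod[of "ws"] ws(2) by simp
qed

lemma act_tr_cox: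
  assumes "a < b" "\<not> int n dvd a - b"
  shows "act (tr a b) \<in> cox_reflections n"
proof -
  obtain g c where g: "g \<in> aff" "g c = a" "g (c + 1) = b"
    using adjacent_preimages[OF assms] by blast
  define i where "i = nat (c mod int n)"
  have i: "i < n" using n0 by (simp add: i_def nat_less_iff)
  have s: "tr c (c + 1) \<in> aff" by (rule tr_aff[OF succ_not_dvd])
  have "tr a b = g \<circ> tr c (c + 1) \<circ> inv g"
    using tr_conj[OF g(1), of c "c + 1"] g by (simp add: fun_eq_iff)
  then have "act (tr a b) = act g \<circ> act (tr c (c + 1)) \<circ> inv (act g)"
    using act_comp[OF aff_comp[OF g(1) s] aff_inv_in[OF g(1)]] act_comp[OF g(1) s] act_inv[OF g(1)] by simp
  moreover have "act (tr c (c + 1)) = root_refl n (simple_root i)"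
    using tr_succ_mod[of c] act_tr[OF succ_not_dvd[of "int i"]] simple_root_rt[OF i] by (simp add: i_def)
  ultimately show ?thesis
    using g(1) i by (auto simp: cox_reflections_def W_aff_act)
qed

lemma pos_real_roots_rt: "pos_real_roots n = {rt a b | a b. a < b \<and> \<not> int n dvd a - b}"
proof
  have fin: "\<exists>i j. \<gamma> = rt i j \<and> 0 < i \<and> i < j \<and> j \<le> int n" if "\<gamma> \<in> fin_pos_roots n" for \<gamma>
  proof -
    obtain i j where ij: "\<gamma> = (\<Sum>k=i..j. simple_root k)" "1 \<le> i" "i \<le> j" "j \<le> n - 1"
      using \<open>\<gamma> \<in> fin_pos_roots n\<close> by (auto simp: fin_pos_roots_def)
    then have "\<gamma> = rt (int i) (int (Suc j))"
      using sum_simple_roots[of i "Suc j"] n0 by (simp add: atLeastLessThanSuc_atLeastAtMost)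
    then show ?thesis using ij n0 by (intro exI[of _ "int i"] exI[of _ "int (Suc j)"]) auto
  qed
  show "pos_real_roots n \<subseteq> {rt a b | a b. a < b \<and> \<not> int n dvd a - b}"
  proof
    fix \<beta> assume "\<beta> \<in> pos_real_roots n"
    then obtain \<gamma> m where \<beta>: "\<beta> = \<gamma> + smul m (delta n)" "\<gamma> \<in> fin_roots n"
      "m > 0 \<or> m = 0 \<and> \<gamma> \<in> fin_pos_roots n" by (auto simp: pos_real_roots_def)
    have "\<exists>i j. \<gamma> = rt i j \<and> \<bar>i - j\<bar> < int n \<and> i \<noteq> j \<and> (\<gamma> \<in> fin_pos_roots n \<longrightarrow> i < j)"
    proof (cases "\<gamma> \<in> fin_pos_roots n")
      case True
      then obtain i j where "\<gamma> = rt i j" "0 < i" "i < j" "j \<le> int n" using fin by blast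
      then show ?thesis by (intro exI[of _ i] exI[of _ j]) auto
    next
      case False
      then have "- \<gamma> \<in> fin_pos_roots n" using \<beta>(2) by (auto simp: fin_roots_def)
      then obtain i j where "- \<gamma> = rt i j" "0 < i" "i < j" "j \<le> int n" using fin by blast
      moreover from this have "\<gamma> = rt j i" using rt_minus[of i j] by (metis minus_minus)
      ultimately show ?thesis using False by (intro exI[of _ j] exI[of _ i]) auto
    qed
    then obtain i j where ij: "\<gamma> = rt i j" "\<bar>i - j\<bar> < int n" "i \<noteq> j" "\<gamma> \<in> fin_pos_roots n \<longrightarrow> i < j" by blast
    have "\<beta> = rt i (j + m * int n)" using \<beta>(1) ij(1) rt_delta by simp
    moreover have "i < j + m * int n"
    proof (cases "m > 0")
      case True
      then have "1 * int n \<le> m * int n" by (intro mult_right_mono) simp_all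
      then show ?thesis using ij(2) by linarith
    qed (use \<beta>(3) ij(4) in auto)
    moreover have "\<not> int n dvd i - (j + m * int n)"
    proof
      assume "int n dvd i - (j + m * int n)"
      then have "int n dvd i - j" using dvd_diff_trans[of i "j + m * int n" j] by simp
      then show False using small_dvd ij(2,3) by fastforce
    qed
    ultimately show "\<beta> \<in> {rt a b | a b. a < b \<and> \<not> int n dvd a - b}" by blast
  qed
  show "{rt a b | a b. a < b \<and> \<not> int n dvd a - b} \<subseteq> pos_real_roots n"
  proof clarify
    fix a b assume ab: "a < b" "\<not> int n dvd a - b"
    have fin: "rt i j \<in> fin_pos_roots n" if "1 \<le> i" "i < j" "j \<le> int n" for i j
    proof -
      have "rt i j = (\<Sum>k=nat i..nat j - 1. simple_root k)"
        using sum_simple_roots[of "nat i" "nat j"] that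
        by (simp add: atLeastLessThanSuc_atLeastAtMost[symmetric])
      then show ?thesis using that unfolding fin_pos_roots_def
        by (intro CollectI exI[of _ "nat i"] exI[of _ "nat j - 1"]) (auto simp: nat_le_iff nat_less_iff)
    qed
    \<comment> \<open>The finite simple roots involve \<open>e_1\<close> to \<open>e_n\<close>, so
      representatives are taken in this range; passing back to \<open>a\<close> and \<open>b\<close>
      adds a multiple of \<open>\<delta>\<close>.\<close>
    obtain a' where a': "int n dvd a' - a" "int n - int n < a'" "a' \<le> int n" using window_rep .
    obtain b' where b': "int n dvd b' - b" "int n - int n < b'" "b' \<le> int n" using window_rep .
    obtain k where k: "a = a' + k * int n" using a'(1) dvd_diff_sym dvd_diffE by metis
    obtain l where l: "b = b' + l * int n" using b'(1) dvd_diff_sym dvd_diffE by metis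
    have rt: "rt a b = rt a' b' + smul (l - k) (delta n)"
      using rt_shift[of a' k "b' + (l - k) * int n"] k l by (simp add: rt_delta algebra_simps)
    have "(l - k) * int n > a' - b'" using k l ab(1) by (simp add: algebra_simps)
    show "rt a b \<in> pos_real_roots n"
    proof (cases "a' < b'")
      case True
      have "l - k \<ge> 0"
      proof (rule ccontr)
        assume "\<not> l - k \<ge> 0"
        then have "(l - k) * int n \<le> (-1) * int n" by (intro mult_right_mono) simp_all
        then show False using \<open>(l - k) * int n > a' - b'\<close> a' b' by linarith
      qed
      moreover have "rt a' b' \<in> fin_pos_roots n" using fin True a' b' by simp
      ultimately show ?thesis
        unfolding pos_real_roots_def fin_roots_def rt by (intro CollectI exI[of _ "rt a' b'"] exI[of _ "l - k"]) auto
    next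
      case False
      have "a' \<noteq> b'"
      proof
        assume "a' = b'"
        then have "int n dvd a - b" using k l by simp
        then show False using ab(2) by simp
      qed
      then have "b' < a'" using False by simp
      then have "l - k > 0"
        using \<open>(l - k) * int n > a' - b'\<close> n0 by (metis add_less_same_cancel2 diff_gt_0_iff_gt less_trans mult_pos_pos of_nat_0_less_iff zero_less_mult_iff not_less_iff_gr_or_eq)
      moreover have "rt b' a' \<in> fin_pos_roots n" using fin \<open>b' < a'\<close> a' b' by simp
      then have "rt a' b' \<in> fin_roots n"
        unfolding fin_roots_def using rt_minus[of b' a'] by (metis UnI2 image_eqI)
      ultimately show ?thesis
        unfolding pos_real_roots_def rt by blast
    qed
  qed
qed

lemma rt_residue: "rt a b (nat (k mod int n)) = cnt k b - cnt k a"
proof -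
  define r where "r = k mod int n"
  have r: "0 \<le> r" "nat r < n" using n0 by (simp_all add: r_def nat_less_iff)
  have "k = r + (k div int n) * int n" by (simp add: r_def)
  then have "cnt k c = cnt r c - k div int n" for c by (metis cnt_shift_left)
  then show ?thesis using r by (simp add: rt_apply flip: r_def)
qed

lemma rt_less_delta_iff: "a < b \<Longrightarrow> rt a b < delta n \<longleftrightarrow> b - a < int n"
proof
  assume "rt a b < delta n"
  then have le: "\<And>j. rt a b j \<le> delta n j" and "\<exists>j. \<not> delta n j \<le> rt a b j"
    unfolding less_le_not_le le_fun_def by auto
  then obtain j where j: "rt a b j < delta n j" by (auto simp: not_le)
  then have "j < n" by (auto simp: rt_apply delta_apply split: if_splits)
  then have "(\<Sum>j<n. rt a b j) < (\<Sum>j<n. delta n j)"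
    using le j by (intro sum_strict_mono_ex1) auto
  then show "b - a < int n" by (simp add: height_rt delta_apply)
next
  assume "a < b" "b - a < int n"
  then have "rt a b \<le> delta n" unfolding delta_rt[of a] by (intro rt_mono) simp_all
  moreover have "rt a b \<noteq> delta n"
  proof
    assume "rt a b = delta n"
    then have "(\<Sum>j<n. rt a b j) = (\<Sum>j<n. delta n j)" by simp
    then show False using \<open>b - a < int n\<close> by (simp add: height_rt delta_apply)
  qed
  ultimately show "rt a b < delta n" by simp
qed

lemma len_id: "len n id = 0"
  using len_act[OF aff_id] by (simp add: act_id shi_id)

lemma bruhat_le_id:
  assumes "bruhat_le n u id"
  shows "u = id"
proof -
  have "(bruhat_step n)\<^sup>*\<^sup>* u id" using assms by (simp add: bruhat_le_def)
  then show ?thesis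
    by (cases rule: rtranclp.cases) (auto simp: bruhat_step_def len_id)
qed

lemma bruhat_le_len:
  assumes "bruhat_le n u v" "u \<noteq> v"
  shows "len n u < len n v"
proof -
  have "(bruhat_step n)\<^sup>*\<^sup>* u v" using assms(1) by (simp add: bruhat_le_def)
  then have "u = v \<or> len n u < len n v"
    by (induction rule: rtranclp_induct) (auto simp: bruhat_step_def)
  then show ?thesis using assms(2) by simp
qed

text \<open>By \<open>cross_tr_le\<close> every edge raises the crossing numbers by at most its own
  coefficients.\<close>

lemma chain_cross:
  assumes "chain n u v e" "u = id"
  shows "\<exists>f\<in>aff. v = act f \<and> (\<forall>k. cross f k \<le> e (nat (k mod int n)))"
  using assms
proof (induction rule: chain.induct)
  case (chain_empty u)
  have "cross id k \<le> 0 (nat (k mod int n))" for k by (simp add: cross_def)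
  moreover have "u = act id" unfolding act_id by (rule chain_empty)
  ultimately show ?case using aff_id by blast
next
  case (chain_edge u v d \<beta>)
  then obtain f where f: "f \<in> aff" "v = act f" "\<And>k. cross f k \<le> d (nat (k mod int n))" by blast
  obtain a b where ab: "\<beta> = rt a b" "a < b" "\<not> int n dvd a - b"
    using chain_edge.hyps by (auto simp: pos_real_roots_rt)
  have t: "tr a b \<in> aff" by (rule tr_aff[OF ab(3)])
  have "v \<circ> root_refl n \<beta> = act (f \<circ> tr a b)"
    unfolding f(2) ab(1) act_comp[OF f(1) t] act_tr[OF ab(3)] ..
  moreover have "cross (f \<circ> tr a b) k \<le> (d + \<beta>) (nat (k mod int n))" for k
    using cross_tr_le[OF f(1) ab(3,2), of k] f(3)[of k] rt_residue[of a b k] by (simp add: ab(1))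
  ultimately show ?case using aff_comp[OF f(1) t] by blast
qed

text \<open>With \<open>\<beta> = e_x - e_y\<close>, the first factor is the reflection in
  \<open>c - \<beta> = e_y - e_(x + n)\<close>.\<close>

lemma tau_eq_tr:
  assumes "x < y" "y < x + int n"
  shows "tau x y = tr y (x + int n) \<circ> tr x y"
proof
  fix i
  have "\<not> int n dvd x - y" "\<not> int n dvd y - x"
    using assms small_dvd[of "x - y"] small_dvd[of "y - x"] by auto
  have shift: "int n dvd z - (x + int n) \<longleftrightarrow> int n dvd z - x" for z
    using dvd_diff_left[of "x + int n" x z] dvd_diff_sym[of z] by simp
  have nd: "\<not> int n dvd y - (x + int n)" using shift \<open>\<not> int n dvd y - x\<close> by simp
  consider "int n dvd i - x" | "int n dvd i - y" | "\<not> int n dvd i - x" "\<not> int n dvd i - y" by blast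
  then show "tau x y i = (tr y (x + int n) \<circ> tr x y) i"
  proof cases
    case 1
    then have "\<not> int n dvd i - y" using dvd_diff_left \<open>\<not> int n dvd x - y\<close> by blast
    moreover have "int n dvd i - x + y - y" using 1 by simp
    ultimately show ?thesis using 1 by (simp add: tau_def tr_def)
  next
    case 2
    then have "\<not> int n dvd i - x" using dvd_diff_left \<open>\<not> int n dvd y - x\<close> by blast
    then have "tr x y i = i - y + x" using 2 by (simp add: tr_def)
    moreover have "int n dvd i - y + x - x" using 2 by simp
    then have "int n dvd i - y + x - (x + int n)" "\<not> int n dvd i - y + x - y"
      using shift dvd_diff_left \<open>\<not> int n dvd x - y\<close> by blast+
    then have "tr y (x + int n) (i - y + x) = i - y + x - (x + int n) + y"
      by (simp only: tr_def if_False if_True)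
    ultimately show ?thesis using 2 \<open>\<not> int n dvd i - x\<close> by (simp add: tau_def)
  next
    case 3
    then show ?thesis using shift by (simp add: tau_def tr_other)
  qed
qed

lemma tau_shift: "tau x (y + int n) = tau x y"
proof -
  have "int n dvd i - (y + int n) \<longleftrightarrow> int n dvd i - y" for i
    using dvd_diff_left[of "y + int n" y i] dvd_diff_sym[of i] by simp
  then show ?thesis by (simp add: fun_eq_iff tau_def)
qed

end

subsection \<open>The curve neighborhood\<close>

locale affine_root = affine_A n + root_modulus "int n" p q for n p q
begin

lemma deg_residue: "(delta n + rt p q) (nat (k mod int n)) = deg k"
  using rt_residue[of p q k] rt_residue[of 0 "0 + int n" k] cnt_shift[of k 0 1]
  by (simp add: deg_def delta_rt[of 0])

lemma reachable_deg_bounded: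
  assumes "v \<in> reachable n (delta n + rt p q) id"
  shows "\<exists>f\<in>deg_bounded. v = act f"
proof -
  obtain u e where u: "bruhat_le n u id" "chain n u v e" and e: "e \<le> delta n + rt p q"
    using assms by (auto simp: reachable_def)
  then have "chain n id v e" using bruhat_le_id by blast
  then obtain f where f: "f \<in> aff" "v = act f" "\<And>k. cross f k \<le> e (nat (k mod int n))"
    using chain_cross[OF _ refl] by blast
  have "cross f k \<le> deg k" for k
    using f(3)[of k] e deg_residue[of k] unfolding le_fun_def by (metis order_trans)
  then show ?thesis using f by (auto simp: deg_bounded_def)
qed

lemma up_bruhat_step:
  assumes "up f g"
  shows "bruhat_step n (act f) (act g)" "g \<in> aff"
proof -
  obtain a b where f: "f \<in> aff" and ab: "a < b" "\<not> int n dvd a - b" "f a < f b" and g: "g = f \<circ> tr a b"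
    using assms by (auto simp: up_def)
  have t: "tr a b \<in> aff" by (rule tr_aff[OF ab(2)])
  show "g \<in> aff" unfolding g by (rule aff_comp[OF f t])
  then have "len n (act f) < len n (act g)"
    using shi_tr_less[OF f ab] shi_nonneg[of 0 f] by (simp add: len_act f g)
  moreover have "act g = act f \<circ> act (tr a b)" unfolding g by (rule act_comp[OF f t])
  ultimately show "bruhat_step n (act f) (act g)"
    using act_tr_cox[OF ab(1,2)] unfolding bruhat_step_def by blast
qed

lemma up_bruhat_le:
  assumes "up\<^sup>*\<^sup>* f g" "f \<in> aff"
  shows "bruhat_le n (act f) (act g)"
proof -
  have "g \<in> aff \<and> (bruhat_step n)\<^sup>*\<^sup>* (act f) (act g)"
    using assms by (induction rule: rtranclp_induct) (auto dest: up_bruhat_step intro: rtranclp.rtrancl_into_rtrancl)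
  then show ?thesis using assms(2) by (auto simp: bruhat_le_def W_aff_act)
qed

definition nbhd_pairs :: "(int \<times> int) set" where
  "nbhd_pairs = {(x, y). q \<le> x \<and> x < p + int n \<and> q < y \<and> y \<le> p + int n \<and> x \<noteq> y}"

definition nbhd_elt :: "int \<times> int \<Rightarrow> lattice_map" where
  "nbhd_elt = (\<lambda>(x, y). act (tau x y \<circ> tr p q))"

text \<open>For \<open>x > y\<close> the root \<open>rt x y\<close> is negative; adding
  \<open>c\<close> makes it positive and below \<open>c\<close> without changing the
  translation.\<close>

definition root_of :: "int \<times> int \<Rightarrow> lattice_elt" where
  "root_of = (\<lambda>(x, y). if x < y then rt x y else rt x (y + int n))"

lemma tr_pq_aff: "tr p q \<in> aff"
  by (rule tr_aff[OF p_q(1)])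

lemma nbhd_elt_transl: "nbhd_elt xy = transl n (root_of xy) \<circ> root_refl n (rt p q)"
proof -
  obtain x y where xy: "xy = (x, y)" by fastforce
  have "act (tau x y) = transl n (root_of xy)"
    using act_tau[of x y] act_tau[of x "y + int n"] tau_shift[of x y] by (simp add: xy root_of_def)
  then show ?thesis
    by (simp add: xy nbhd_elt_def act_comp[OF tau_aff tr_pq_aff] act_tr[OF p_q(1)])
qed

lemma len_nbhd_elt:
  assumes "xy \<in> nbhd_pairs"
  shows "len n (nbhd_elt xy) = 2 * (n - 1) + len n (root_refl n (rt p q))"
proof -
  obtain x y where xy: "xy = (x, y)" "q \<le> x" "x < p + int n" "q < y" "y \<le> p + int n" "x \<noteq> y"
    using assms by (auto simp: nbhd_pairs_def)
  have "len n (nbhd_elt xy) = nat (shi 0 (tr p q) + 2 * (int n - 1))"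
    using tau_tr_shi[OF xy(2-)] by (simp add: xy(1) nbhd_elt_def len_act aff_comp[OF tau_aff tr_pq_aff])
  also have "\<dots> = 2 * (n - 1) + nat (shi 0 (tr p q))"
  proof -
    have "2 * (int n - 1) = int (2 * (n - 1))" using n0 by (simp add: of_nat_diff)
    moreover have "nat (z + int m) = m + nat z" if "0 \<le> z" for z m using that by simp
    ultimately show ?thesis using shi_nonneg[of 0 "tr p q"] by metis
  qed
  also have "nat (shi 0 (tr p q)) = len n (root_refl n (rt p q))"
    using len_act[OF tr_pq_aff] act_tr[OF p_q(1)] by simp
  finally show ?thesis .
qed

lemma nbhd_elt_reachable:
  assumes "xy \<in> nbhd_pairs"
  shows "nbhd_elt xy \<in> reachable n (delta n + rt p q) id"
proof -
  obtain x y0 where xy0: "xy = (x, y0)" "q \<le> x" "x < p + int n" "q < y0" "y0 \<le> p + int n" "x \<noteq> y0"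
    using assms by (auto simp: nbhd_pairs_def)
  define y where "y = (if x < y0 then y0 else y0 + int n)"
  have y: "x < y" "y < x + int n" using xy0 pq by (auto simp: y_def)
  have nd: "\<not> int n dvd x - y" "\<not> int n dvd y - (x + int n)"
    using y small_dvd[of "x - y"] small_dvd[of "y - (x + int n)"] by auto
  have root: "rt x y \<in> pos_real_roots n" "rt y (x + int n) \<in> pos_real_roots n" "rt p q \<in> pos_real_roots n"
    using y nd pq p_q by (auto simp: pos_real_roots_rt)
  have "id \<in> W_aff n" using aff_id act_id by (force simp: W_aff_act)
  \<comment> \<open>Three edges, of degrees \<open>c - \<beta>\<close>, \<open>\<beta>\<close> and
    \<open>\<alpha>\<close>, use up the degree \<open>c + \<alpha>\<close> exactly.\<close>
  then have "chain n id (id \<circ> root_refl n (rt y (x + int n)) \<circ> root_refl n (rt x y) \<circ> root_refl n (rt p q))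
      (0 + rt y (x + int n) + rt x y + rt p q)"
    by (intro chain_edge chain_empty root)
  moreover have "tau x y0 = tau x y" using tau_shift by (simp add: y_def)
  then have "nbhd_elt xy = act (tr y (x + int n) \<circ> tr x y) \<circ> act (tr p q)"
    unfolding nbhd_elt_def xy0(1) split using act_comp[OF tau_aff tr_pq_aff] tau_eq_tr[OF y] by metis
  then have "nbhd_elt xy = id \<circ> root_refl n (rt y (x + int n)) \<circ> root_refl n (rt x y) \<circ> root_refl n (rt p q)"
    unfolding act_comp[OF tr_aff[OF nd(2)] tr_aff[OF nd(1)]] act_tr[OF nd(1)] act_tr[OF nd(2)] act_tr[OF p_q(1)] by simp
  moreover have "0 + rt y (x + int n) + rt x y + rt p q = delta n + rt p q"
    using rt_add[of x y "x + int n"] by (simp add: delta_rt[of x] add.commute)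
  ultimately have "chain n id (nbhd_elt xy) (delta n + rt p q)" by simp
  moreover have "bruhat_le n id id" using \<open>id \<in> W_aff n\<close> by (simp add: bruhat_le_def)
  moreover have "nbhd_elt xy \<in> W_aff n"
    using aff_comp[OF tau_aff tr_pq_aff] by (auto simp: nbhd_elt_def xy0(1) W_aff_act)
  ultimately show ?thesis unfolding reachable_def by blast
qed

lemma reachable_le_nbhd_elt:
  assumes "v \<in> reachable n (delta n + rt p q) id"
  shows "\<exists>xy\<in>nbhd_pairs. bruhat_le n v (nbhd_elt xy)"
proof -
  obtain f where f: "f \<in> deg_bounded" "v = act f" using reachable_deg_bounded[OF assms] by blast
  then obtain g where g: "maximal g" "up\<^sup>*\<^sup>* f g" using below_maximal by blast
  obtain x y where "q \<le> x" "x < p + int n" "q < y" "y \<le> p + int n" "x \<noteq> y" "g = tau x y \<circ> tr p q"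
    by (rule maximal_classification[OF g(1)])
  then have "(x, y) \<in> nbhd_pairs" "act g = nbhd_elt (x, y)" by (auto simp: nbhd_pairs_def nbhd_elt_def)
  moreover have "bruhat_le n (act f) (act g)" using up_bruhat_le[OF g(2)] f(1) by (simp add: deg_bounded_def)
  ultimately show ?thesis using f(2) by metis
qed

text \<open>Anything reachable lies below some \<open>nbhd_elt\<close>. Since these are reachable
  and of equal length, nothing reachable lies strictly above one of them.\<close>

lemma curve_nbhd_nbhd_elt: "curve_nbhd n (delta n + rt p q) id = nbhd_elt ` nbhd_pairs"
proof
  show "curve_nbhd n (delta n + rt p q) id \<subseteq> nbhd_elt ` nbhd_pairs"
  proof
    fix v assume v: "v \<in> curve_nbhd n (delta n + rt p q) id"
    then have "v \<in> reachable n (delta n + rt p q) id" by (simp add: curve_nbhd_def)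
    then obtain xy where xy: "xy \<in> nbhd_pairs" "bruhat_le n v (nbhd_elt xy)"
      using reachable_le_nbhd_elt by blast
    then have "nbhd_elt xy = v" using v nbhd_elt_reachable by (auto simp: curve_nbhd_def)
    then show "v \<in> nbhd_elt ` nbhd_pairs" using xy(1) by blast
  qed
  show "nbhd_elt ` nbhd_pairs \<subseteq> curve_nbhd n (delta n + rt p q) id"
  proof clarify
    fix x y assume xy: "(x, y) \<in> nbhd_pairs"
    have "w = nbhd_elt (x, y)" if w: "w \<in> reachable n (delta n + rt p q) id" "bruhat_le n (nbhd_elt (x, y)) w" for w
    proof (rule ccontr)
      assume "w \<noteq> nbhd_elt (x, y)"
      then have less: "len n (nbhd_elt (x, y)) < len n w" using bruhat_le_len[OF w(2)] by simp
      obtain zw where zw: "zw \<in> nbhd_pairs" "bruhat_le n w (nbhd_elt zw)" using reachable_le_nbhd_elt[OF w(1)] by blast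
      then have "len n w \<le> len n (nbhd_elt zw)" using bruhat_le_len[of w "nbhd_elt zw"] by (cases "w = nbhd_elt zw") auto
      then show False using less len_nbhd_elt[OF xy] len_nbhd_elt[OF zw(1)] by simp
    qed
    then show "nbhd_elt (x, y) \<in> curve_nbhd n (delta n + rt p q) id"
      using nbhd_elt_reachable[OF xy] by (auto simp: curve_nbhd_def)
  qed
qed

text \<open>The translation reveals the class it raises and the class it lowers, and the allowed
  ranges are too short to contain two congruent candidates.\<close>

lemma nbhd_elt_inj: "inj_on nbhd_elt nbhd_pairs"
proof (rule inj_onI, clarify)
  fix x y x' y' assume xy: "(x, y) \<in> nbhd_pairs" "(x', y') \<in> nbhd_pairs" and eq: "nbhd_elt (x, y) = nbhd_elt (x', y')"
  have "tau x y \<circ> tr p q = tau x' y' \<circ> tr p q"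
    using act_inj[OF aff_comp[OF tau_aff tr_pq_aff] aff_comp[OF tau_aff tr_pq_aff]] eq by (simp add: nbhd_elt_def)
  then have tau: "tau x y i = tau x' y' i" for i
    using tr_tr[OF p_q(1), of i] by (metis comp_apply)
  have "tau a b i > i \<longleftrightarrow> int n dvd i - a" "tau a b i < i \<longleftrightarrow> int n dvd i - b" if "(a, b) \<in> nbhd_pairs" for a b i
  proof -
    have "a \<noteq> b" "\<bar>a - b\<bar> < int n" using that pq by (auto simp: nbhd_pairs_def)
    then have "\<not> int n dvd a - b" using small_dvd[of "a - b"] by auto
    then have "\<not> (int n dvd i - a \<and> int n dvd i - b)" using dvd_diff_left by blast
    then show "tau a b i > i \<longleftrightarrow> int n dvd i - a" "tau a b i < i \<longleftrightarrow> int n dvd i - b"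
      using n0 by (auto simp: tau_def)
  qed
  then have "int n dvd x - x'" "int n dvd y - y'"
    using tau[of x] tau[of y] xy by (metis cancel_comm_monoid_add_class.diff_cancel dvd_0_right)+
  moreover have "\<bar>x - x'\<bar> < int n" "\<bar>y - y'\<bar> < int n" using xy pq by (auto simp: nbhd_pairs_def)
  ultimately show "x = x' \<and> y = y'" using small_dvd by fastforce
qed

section \<open>Matching the pairs with the roots of the theorem\<close>

lemma finite_nbhd_pairs: "finite nbhd_pairs"
proof (rule finite_subset)
  show "nbhd_pairs \<subseteq> {q..p + int n} \<times> {q..p + int n}" by (auto simp: nbhd_pairs_def)
qed simp

text \<open>For \<open>x < y\<close> the interval from \<open>x\<close> to \<open>y\<close> lies in
  that from \<open>q\<close> to \<open>p + n\<close>, which is \<open>c - \<alpha>\<close>.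
  Otherwise the interval from \<open>x\<close> to \<open>y + n\<close> contains a translate of that
  of \<open>\<alpha>\<close>, and no end is congruent to \<open>p\<close> or \<open>q\<close>,
  whence orthogonality.\<close>

lemma root_of_roots_for:
  assumes "xy \<in> nbhd_pairs"
  shows "root_of xy \<in> roots_for n (rt p q)"
proof -
  obtain x y where xy: "xy = (x, y)" "q \<le> x" "x < p + int n" "q < y" "y \<le> p + int n" "x \<noteq> y"
    using assms by (auto simp: nbhd_pairs_def)
  define y' where "y' = (if x < y then y else y + int n)"
  have root: "root_of xy = rt x y'" by (simp add: xy(1) root_of_def y'_def)
  have y': "x < y'" "y' < x + int n" using xy pq by (auto simp: y'_def)
  then have "rt x y' \<in> pos_real_roots n" "rt x y' < delta n"
    using small_dvd[of "x - y'"] rt_less_delta_iff by (auto simp: pos_real_roots_rt)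
  moreover have "rt x y' \<le> delta n - rt p q \<or> rt p q < rt x y' \<and> form n (rt x y') (rt p q) = 0"
  proof (cases "x < y")
    case True
    have "delta n - rt p q = rt q (p + int n)"
      using rt_add[of p q "p + int n"] by (simp add: delta_rt[of p] algebra_simps)
    then show ?thesis using rt_mono[of q x y "p + int n"] xy True by (simp add: y'_def)
  next
    case False
    then have o: "q < y" "y < x" "x < p + int n" "y' = y + int n" using xy by (auto simp: y'_def)
    have "rt p q = rt (p + int n) (q + int n)" using rt_shift[of p 1 q] by simp
    then have le: "rt p q \<le> rt x y'" using rt_mono[of x "p + int n" "q + int n" y'] o by simp
    moreover have "rt p q \<noteq> rt x y'"
    proof
      assume "rt p q = rt x y'"
      then have "(\<Sum>j<n. rt p q j) = (\<Sum>j<n. rt x y' j)" by simp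
      then show False using o by (simp add: height_rt)
    qed
    moreover have "form n (rt x y') (rt p q) = 0"
    proof -
      have "\<not> int n dvd x - p" "\<not> int n dvd x - q" "\<not> int n dvd y - p" "\<not> int n dvd y - q"
        using o pq small_dvd[of "x - p"] small_dvd[of "x - q"] small_dvd[of "y - p"] small_dvd[of "y - q"] by auto
      moreover have "int n dvd y' - c \<longleftrightarrow> int n dvd y - c" for c
        using dvd_diff_left[of y' y c] o(4) by simp
      ultimately show ?thesis by (simp add: form_rt ecoeff_rt)
    qed
    ultimately show ?thesis by (simp add: order_less_le)
  qed
  ultimately show ?thesis by (simp add: roots_for_def root)
qed

lemma roots_for_root_of:
  assumes "\<beta> \<in> roots_for n (rt p q)"
  shows "\<beta> \<in> root_of ` nbhd_pairs"
proof -
  have \<beta>: "\<beta> \<in> pos_real_roots n" "\<beta> < delta n"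
    "\<beta> \<le> delta n - rt p q \<or> rt p q < \<beta> \<and> form n \<beta> (rt p q) = 0"
    using assms by (auto simp: roots_for_def)
  then obtain a b where ab: "\<beta> = rt a b" "a < b" "\<not> int n dvd a - b" by (auto simp: pos_real_roots_rt)
  obtain x where x: "int n dvd x - a" "p + int n - 1 - int n < x" "x \<le> p + int n - 1" using window_rep .
  obtain m where m: "x = a + m * int n" using x(1) by (rule dvd_diffE)
  define y where "y = b + m * int n"
  have \<beta>rt: "\<beta> = rt x y" using rt_shift[of a m b] ab(1) m by (simp add: y_def)
  have y: "x < y" "y < x + int n"
    using ab \<beta>(2) rt_less_delta_iff[OF ab(2)] by (simp_all add: y_def m)
  have val: "\<beta> (nat (k mod int n)) = cnt k y - cnt k x" for k unfolding \<beta>rt by (rule rt_residue)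
  have cnt0: "cnt k c = 0" if "k - int n < c" "c \<le> k" for k c
    using that cnt_nonpos[of k c] cnt_pos[of k "c + int n"] cnt_shift[of k c 1] by simp
  have cnt1: "cnt k c = 1" if "k < c" "c \<le> k + int n" for k c
    using that cnt_pos[of k c] cnt_nonpos[of k "c - int n"] cnt_shift[of k c "-1"] by simp
  show ?thesis
  proof (cases "\<beta> \<le> delta n - rt p q")
    case True
    have sum: "(cnt k y - cnt k x) + (cnt k q - cnt k p) \<le> 1" for k
    proof -
      have "\<beta> (nat (k mod int n)) + rt p q (nat (k mod int n)) \<le> delta n (nat (k mod int n))"
        using True unfolding le_fun_def by (simp add: le_diff_eq)
      then show ?thesis using val rt_residue[of p q k] by (simp add: delta_apply split: if_splits)
    qed
    \<comment> \<open>Otherwise wall \<open>x\<close> would be covered by both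
      \<open>\<alpha>\<close> and \<open>\<beta>\<close>; below, wall \<open>p + n\<close> plays the
      same role for the other end.\<close>
    have "q \<le> x"
    proof (rule ccontr)
      assume "\<not> q \<le> x"
      then have "cnt x y = 1" "cnt x x = 0" "cnt x q = 1" "cnt x p = 0"
        using x y pq by (auto intro!: cnt0 cnt1)
      then show False using sum[of x] by simp
    qed
    moreover have "y \<le> p + int n"
    proof (rule ccontr)
      assume "\<not> y \<le> p + int n"
      then have "cnt (p + int n) y = 1" "cnt (p + int n) x = 0" "cnt p q = 1" "cnt p p = 0"
        using x y pq by (auto intro!: cnt0 cnt1)
      then show False using sum[of "p + int n"] cnt_shift_left[of p 1] by simp
    qed
    ultimately have "(x, y) \<in> nbhd_pairs" "\<beta> = root_of (x, y)"
      using x y \<beta>rt by (auto simp: nbhd_pairs_def root_of_def)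
    then show ?thesis by blast
  next
    case False
    then have lt: "rt p q < \<beta>" and form0: "form n \<beta> (rt p q) = 0" using \<beta>(3) by auto
    have cover: "cnt k q - cnt k p \<le> cnt k y - cnt k x" for k
      using lt val rt_residue[of p q k] unfolding less_le le_fun_def by metis
    have dvds: "(if int n dvd x - p then 1 else 0) - (if int n dvd y - p then 1 else 0)
        = (if int n dvd x - q then 1 else 0) - (if int n dvd y - q then 1 else (0::int))"
      using form0 by (simp add: \<beta>rt form_rt ecoeff_rt)
    have xy: "\<not> (int n dvd x - c \<and> int n dvd y - c)" for c
    proof -
      have "\<not> int n dvd x - y" using y small_dvd[of "x - y"] by auto
      then show ?thesis using dvd_diff_trans dvd_diff_sym by blast
    qed
    have pq': "\<not> (int n dvd z - p \<and> int n dvd z - q)" for z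
      using p_q dvd_diff_left by blast
    \<comment> \<open>Orthogonality excludes a common start or end: if \<open>x\<close> is congruent
      to \<open>p\<close>, the left side of \<open>dvds\<close> is 1, which would force
      \<open>x\<close> to be congruent to \<open>q\<close> too; similarly for
      \<open>y\<close>.\<close>
    have nd: "\<not> int n dvd x - p" "\<not> int n dvd y - q"
      using dvds xy pq' by (auto split: if_splits)
    then have "x \<noteq> p" by auto
    then have px: "p < x" using x by simp
    \<comment> \<open>Otherwise wall \<open>x - 1\<close> is covered by \<open>\<alpha>\<close> but
      not by \<open>\<beta>\<close>.\<close>
    have qx: "q \<le> x"
    proof (rule ccontr)
      assume "\<not> q \<le> x"
      then have "cnt (x - 1) q = 1" "cnt (x - 1) p = 0" "cnt (x - 1) x = 1" "cnt (x - 1) y \<le> 1"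
        using px pq y cnt_mono[of y "x - 1 + int n" "x - 1"] cnt1[of "x - 1" "x - 1 + int n"]
        by (auto intro!: cnt0 cnt1)
      then show False using cover[of "x - 1"] by simp
    qed
    \<comment> \<open>\<open>\<alpha>\<close> covers wall \<open>q - 1\<close>; as
      \<open>\<beta>\<close> starts at or after \<open>q\<close>, it can cover only the translate
      \<open>q - 1 + n\<close>.\<close>
    have "q + int n \<le> y"
    proof (rule ccontr)
      assume "\<not> q + int n \<le> y"
      moreover have "cnt (q - 1) q = 1" "cnt (q - 1) p = 0" "cnt (q - 1) x = 1"
        using pq qx x by (auto intro!: cnt0 cnt1)
      moreover have "cnt (q - 1) y \<le> cnt (q - 1) (q - 1 + int n)"
        using calculation(1) by (intro cnt_mono) simp
      moreover have "cnt (q - 1) (q - 1 + int n) = 1" using n0 by (intro cnt1) simp_all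
      ultimately show False using cover[of "q - 1"] by simp
    qed
    moreover have "y \<noteq> q + int n" using nd(2) by auto
    ultimately have "(x, y - int n) \<in> nbhd_pairs" "\<beta> = root_of (x, y - int n)"
      using x y qx \<beta>rt by (auto simp: nbhd_pairs_def root_of_def)
    then show ?thesis by blast
  qed
qed

lemma roots_for_eq: "roots_for n (rt p q) = root_of ` nbhd_pairs"
  using root_of_roots_for roots_for_root_of by blast

lemma curve_nbhd_transl:
  "curve_nbhd n (delta n + rt p q) id = (\<lambda>\<beta>. transl n \<beta> \<circ> root_refl n (rt p q)) ` roots_for n (rt p q)"
  unfolding curve_nbhd_nbhd_elt roots_for_eq by (simp add: image_image nbhd_elt_transl)

lemma inj_transl: "inj_on (\<lambda>\<beta>. transl n \<beta> \<circ> root_refl n (rt p q)) (roots_for n (rt p q))"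
proof -
  have "inj_on ((\<lambda>\<beta>. transl n \<beta> \<circ> root_refl n (rt p q)) \<circ> root_of) nbhd_pairs"
    using nbhd_elt_inj nbhd_elt_transl by (simp add: inj_on_def)
  then show ?thesis unfolding roots_for_eq by (rule inj_on_imageI)
qed

end

theorem theorem1p10:
  fixes n :: nat and \<alpha> :: lattice_elt
  assumes "n \<ge> 3"
    and "\<alpha> \<in> pos_real_roots n"
    and "\<alpha> < delta n"
  shows "curve_nbhd n (delta n + \<alpha>) id =
           {transl n \<beta> \<circ> root_refl n \<alpha> | \<beta>. \<beta> \<in> roots_for n \<alpha> \<and> simple_root 0 \<notin> supp n \<beta>}
           \<union> {transl n (\<beta> - delta n) \<circ> root_refl n \<alpha> | \<beta>.
                \<beta> \<in> roots_for n \<alpha> \<and> simple_root 0 \<in> supp n \<beta>}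
         \<and> (finite (curve_nbhd n (delta n + \<alpha>) id) \<and> finite (roots_for n \<alpha>)
            \<and> card (curve_nbhd n (delta n + \<alpha>) id) = card (roots_for n \<alpha>))
         \<and> (\<forall>w \<in> curve_nbhd n (delta n + \<alpha>) id.
              len n w = 2 * (n - 1) + len n (root_refl n \<alpha>))"
proof -
  interpret affine_A n by unfold_locales (rule assms(1))
  obtain p q where \<alpha>: "\<alpha> = rt p q" "p < q" using assms(2) by (auto simp: pos_real_roots_rt)
  interpret affine_root n p q
    by unfold_locales (use \<alpha> assms(3) rt_less_delta_iff[of p q] in auto)
  have "curve_nbhd n (delta n + \<alpha>) id = (\<lambda>\<beta>. transl n \<beta> \<circ> root_refl n \<alpha>) ` roots_for n \<alpha>"
    unfolding \<alpha>(1) by (rule curve_nbhd_transl)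
  moreover have "finite (roots_for n \<alpha>)" unfolding \<alpha>(1) roots_for_eq using finite_nbhd_pairs by simp
  moreover have "card ((\<lambda>\<beta>. transl n \<beta> \<circ> root_refl n \<alpha>) ` roots_for n \<alpha>) = card (roots_for n \<alpha>)"
    unfolding \<alpha>(1) by (rule card_image[OF inj_transl])
  moreover have "\<forall>w \<in> curve_nbhd n (delta n + \<alpha>) id. len n w = 2 * (n - 1) + len n (root_refl n \<alpha>)"
    unfolding \<alpha>(1) curve_nbhd_nbhd_elt using len_nbhd_elt by blast
  ultimately show ?thesis unfolding transl_minus_delta by auto
qed

end
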